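(* Let $F$ be a minor-closed family of graphs which excludes a graph $M$ as a minor, where $M$ has $n$ vertices. Then there exists an infinite family of graphs $H_1,H_2,\dots$, each of treewidth at most $n+1$, such that for every $i$, any $\alpha$-approximation of the metric of $H_i$ by a distribution over dominating graph metrics of graphs in $F$ has $\alpha=\Omega(\log |H_i|)$, where the constant implicit in $\Omega$ may depend on $n$ (polynomially) but not on $i$.
   Context: Graphs carry their shortest-path metric (unit edge lengths). For a graph $H$ with metric $d_H$, an $\alpha$-approximation of $d_H$ by a distribution over dominating graph metrics in $F$ is a probability distribution over pairs $(U,\Phi_U)$, where $U\in F$ and $\Phi_U$ maps the vertices of $H$ to vertices of $U$, such that for all vertices $x,y$ of $H$: $d_U(\Phi_U(x),\Phi_U(y))\ge d_H(x,y)$ for every $U$ in the support (domination), and $\mathbb{E}[d_U(\Phi_U(x),\Phi_U(y))]\le \alpha\, d_H(x,y)$. $|H_i|$ denotes the size of $H_i$. *)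

theory Defs
  imports "HOL-Probability.Probability"
begin

type_synonym graph = "nat set \<times> nat set set"

definition verts :: "graph \<Rightarrow> nat set" where "verts G = fst G"
definition edges :: "graph \<Rightarrow> nat set set" where "edges G = snd G"

definition wf_graph :: "graph \<Rightarrow> bool" where
  "wf_graph G \<longleftrightarrow> finite (verts G) \<and>
     (\<forall>e\<in>edges G. \<exists>u v. u \<noteq> v \<and> e = {u, v} \<and> u \<in> verts G \<and> v \<in> verts G)"

definition adj :: "graph \<Rightarrow> nat \<Rightarrow> nat \<Rightarrow> bool" where
  "adj G u v \<longleftrightarrow> u \<in> verts G \<and> v \<in> verts G \<and> u \<noteq> v \<and> {u, v} \<in> edges G"

definition connected_set :: "graph \<Rightarrow> nat set \<Rightarrow> bool" where
  "connected_set G S \<longleftrightarrow> S \<noteq> {} \<and> S \<subseteq> verts G \<and>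
     (\<forall>u\<in>S. \<forall>v\<in>S. (\<lambda>x y. adj G x y \<and> x \<in> S \<and> y \<in> S)\<^sup>*\<^sup>* u v)"

definition is_minor :: "graph \<Rightarrow> graph \<Rightarrow> bool" where
  "is_minor H G \<longleftrightarrow> (\<exists>B :: nat \<Rightarrow> nat set.
     (\<forall>v\<in>verts H. connected_set G (B v)) \<and>
     (\<forall>u\<in>verts H. \<forall>v\<in>verts H. u \<noteq> v \<longrightarrow> B u \<inter> B v = {}) \<and>
     (\<forall>u v. adj H u v \<longrightarrow> (\<exists>x\<in>B u. \<exists>y\<in>B v. adj G x y)))"

definition minor_closed :: "graph set \<Rightarrow> bool" where
  "minor_closed F \<longleftrightarrow> (\<forall>G\<in>F. \<forall>H. wf_graph H \<and> is_minor H G \<longrightarrow> H \<in> F)"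

definition is_tree :: "graph \<Rightarrow> bool" where
  "is_tree T \<longleftrightarrow> wf_graph T \<and> connected_set T (verts T) \<and>
     card (edges T) + 1 = card (verts T)"

definition tree_decomposition :: "graph \<Rightarrow> graph \<Rightarrow> (nat \<Rightarrow> nat set) \<Rightarrow> bool" where
  "tree_decomposition G T bag \<longleftrightarrow> is_tree T \<and>
     (\<forall>t\<in>verts T. bag t \<subseteq> verts G) \<and>
     (\<forall>v\<in>verts G. \<exists>t\<in>verts T. v \<in> bag t) \<and>
     (\<forall>u v. adj G u v \<longrightarrow> (\<exists>t\<in>verts T. u \<in> bag t \<and> v \<in> bag t)) \<and>
     (\<forall>v\<in>verts G. connected_set T {t\<in>verts T. v \<in> bag t})"

definition treewidth_le :: "graph \<Rightarrow> nat \<Rightarrow> bool" where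
  "treewidth_le G k \<longleftrightarrow> (\<exists>T bag. tree_decomposition G T bag \<and>
     (\<forall>t\<in>verts T. card (bag t) \<le> k + 1))"

definition gdist :: "graph \<Rightarrow> nat \<Rightarrow> nat \<Rightarrow> enat" where
  "gdist G x y = (if \<exists>n. (adj G ^^ n) x y then enat (LEAST n. (adj G ^^ n) x y) else \<infinity>)"

definition is_approx :: "graph set \<Rightarrow> graph \<Rightarrow> real \<Rightarrow> (graph \<times> (nat \<Rightarrow> nat)) pmf \<Rightarrow> bool" where
  "is_approx F H \<alpha> D \<longleftrightarrow>
     (\<forall>p\<in>set_pmf D. fst p \<in> F \<and> (\<forall>x\<in>verts H. snd p x \<in> verts (fst p)) \<and>
        (\<forall>x\<in>verts H. \<forall>y\<in>verts H. gdist (fst p) (snd p x) (snd p y) \<ge> gdist H x y)) \<and>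
     (\<forall>x\<in>verts H. \<forall>y\<in>verts H.
        (\<integral>\<^sup>+ p. ennreal_of_enat (gdist (fst p) (snd p x) (snd p y)) \<partial>measure_pmf D)
          \<le> ennreal \<alpha> * ennreal_of_enat (gdist H x y))"

end

theory Submission
  imports Defs
begin

text \<open>
  The gadget joins a source to \<open>n\<close> left vertices, these to \<open>n\<close> right vertices by a \<open>K\<^bsub>n,n\<^esub>\<close>, and
  these to a sink, so that every edge lies on a geodesic of length 3 from source to sink.  The
  \<open>i\<close>-th graph arises from one edge by replacing all edges by gadgets \<open>i\<close> times; all bags consist
  of \<open>n\<close> left vertices and two further vertices.

  Consider a gadget whose edges have later been subdivided into geodesics of length \<open>3\<^sup>m\<close>.  If
  each edge of a choice of these geodesics were stretched by less than \<open>3\<^sup>m/6\<close>, then small balls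
  around the image would give a model of \<open>K\<^bsub>n,n\<^esub>\<close>, which contains \<open>K\<^sub>n\<close> as a minor, in the host
  graph.  Hence for every scale \<open>m < i\<close> a random edge has stretch at least \<open>3\<^sup>m/6\<close> with
  probability at least \<open>3\<^sup>-\<^sup>m/(3n\<^sup>2)\<close>.  Each scale thus contributes a constant to the expected stretch,
  which is therefore of order \<open>i/n\<^sup>2\<close>.
\<close>

section \<open>Minors from cores and paths\<close>

definition reach :: "graph \<Rightarrow> nat set \<Rightarrow> nat \<Rightarrow> nat \<Rightarrow> bool" where
  "reach G X = (\<lambda>x y. adj G x y \<and> x \<in> X \<and> y \<in> X)\<^sup>*\<^sup>*"

lemma adj_sym: "adj G x y \<Longrightarrow> adj G y x"
  by (auto simp: adj_def insert_commute)

lemma relpowp_adj_sym: "(adj G ^^ t) x y \<Longrightarrow> (adj G ^^ t) y x"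
proof (induction t arbitrary: x y)
  case (Suc t)
  then obtain z where "(adj G ^^ t) x z" "adj G z y" by auto
  then show ?case using Suc.IH adj_sym relpowp_Suc_I2 by metis
qed auto

lemma reach_refl [simp]: "reach G X x x"
  by (simp add: reach_def)

lemma reach_trans: "reach G X x y \<Longrightarrow> reach G X y z \<Longrightarrow> reach G X x z"
  unfolding reach_def by (rule rtranclp_trans)

lemma reach_step: "adj G x y \<Longrightarrow> x \<in> X \<Longrightarrow> y \<in> X \<Longrightarrow> reach G X x y"
  unfolding reach_def by auto

lemma reach_sym: "reach G X x y \<Longrightarrow> reach G X y x"
  unfolding reach_def
proof (induction rule: rtranclp_induct)
  case (step y z)
  then show ?case
    by (metis (mono_tags, lifting) adj_sym converse_rtranclp_into_rtranclp)
qed simp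

lemma reach_mono: "reach G X x y \<Longrightarrow> X \<subseteq> Y \<Longrightarrow> reach G Y x y"
  unfolding reach_def by (erule rtranclp_mono[THEN predicate2D, rotated]) auto

lemma reach_in: "reach G X x y \<Longrightarrow> x \<in> X \<Longrightarrow> y \<in> X"
  unfolding reach_def by (induction rule: rtranclp_induct) auto

lemma reach_component:
  assumes "reach G X p z"
  shows "reach G {z. reach G X p z} p z"
  using assms unfolding reach_def[of G X]
proof (induction rule: rtranclp_induct)
  case (step y z)
  let ?C = "{z. (\<lambda>x y. adj G x y \<and> x \<in> X \<and> y \<in> X)\<^sup>*\<^sup>* p z}"
  have "z \<in> ?C" using rtranclp.rtrancl_into_rtrancl[OF step.hyps] by simp
  then have "reach G ?C y z" using step.hyps by (intro reach_step) auto
  then show ?case using step.IH reach_trans by blast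
qed simp

lemma connected_setI:
  assumes "h \<in> S" "S \<subseteq> verts G" "\<And>z. z \<in> S \<Longrightarrow> reach G S h z"
  shows "connected_set G S"
  unfolding connected_set_def
  using assms reach_trans[OF reach_sym] unfolding reach_def by blast

lemma connected_set_reach:
  "connected_set G S \<Longrightarrow> x \<in> S \<Longrightarrow> y \<in> S \<Longrightarrow> reach G S x y"
  unfolding connected_set_def reach_def by blast

text \<open>The walk is cut at its first entry into \<open>S\<close>: \<open>y\<close> is the entry
  point, and everything up to its predecessor \<open>x\<close> avoids \<open>S\<close>.\<close>

lemma reach_exit:
  assumes "reach G P p z" "z \<in> S" "p \<notin> S"
  shows "\<exists>x\<in>-S. \<exists>y\<in>S. reach G (P - S) p x \<and> adj G x y"
proof -
  let ?E = "\<exists>x\<in>-S. \<exists>y\<in>S. reach G (P - S) p x \<and> adj G x y"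
  have "reach G (P - S) p z \<and> z \<notin> S \<or> ?E"
    using assms(1) unfolding reach_def[of G P]
  proof (induction rule: rtranclp_induct)
    case base
    then show ?case using assms(3) by simp
  next
    case (step y z)
    show ?case
    proof (cases "?E")
      case False
      then have y: "reach G (P - S) p y" "y \<notin> S" using step.IH by auto
      then have "z \<notin> S" using step.hyps(2) False by auto
      then have "reach G (P - S) y z" using step.hyps(2) y by (intro reach_step) auto
      then show ?thesis using y \<open>z \<notin> S\<close> reach_trans by blast
    qed simp
  qed
  then show ?thesis using assms(2) by blast
qed

text \<open>The core \<open>S a\<close> and the tail \<open>C a\<close>, the part reachable from
  \<open>p a\<close> outside all cores, form one branch set. Every tail touches every core, so these
  sets realise \<open>K\<^sub>n\<close> and hence any graph on \<open>n\<close> vertices.\<close>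

lemma minor_of_cores:
  fixes S :: "nat \<Rightarrow> nat set" and P :: "nat \<Rightarrow> nat \<Rightarrow> nat set" and p :: "nat \<Rightarrow> nat"
  assumes M: "finite (verts M)" "card (verts M) = n"
    and S: "\<And>b. b < n \<Longrightarrow> connected_set U (S b)"
    and SS: "\<And>b b'. b < n \<Longrightarrow> b' < n \<Longrightarrow> b \<noteq> b' \<Longrightarrow> S b \<inter> S b' = {}"
    and P: "\<And>a b. a < n \<Longrightarrow> b < n \<Longrightarrow> P a b \<subseteq> verts U"
    and pP: "\<And>a b. a < n \<Longrightarrow> b < n \<Longrightarrow> p a \<in> P a b"
    and pS: "\<And>a b. a < n \<Longrightarrow> b < n \<Longrightarrow> p a \<notin> S b"
    and reach: "\<And>a b. a < n \<Longrightarrow> b < n \<Longrightarrow> \<exists>z\<in>S b. reach U (P a b) (p a) z"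
    and PS: "\<And>a b b'. a < n \<Longrightarrow> b < n \<Longrightarrow> b' < n \<Longrightarrow> b \<noteq> b' \<Longrightarrow> P a b \<inter> S b' = {}"
    and PP: "\<And>a b a' b'. a < n \<Longrightarrow> b < n \<Longrightarrow> a' < n \<Longrightarrow> b' < n \<Longrightarrow> a \<noteq> a' \<Longrightarrow>
      P a b \<inter> P a' b' \<subseteq> S b"
  shows "is_minor M U"
proof -
  define Z where "Z = (\<Union>b<n. S b)"
  define Q where "Q a = (\<Union>b<n. P a b) - Z" for a
  define C where "C a = {z. reach U (Q a) (p a) z}" for a
  have pQ: "p a \<in> Q a" if "a < n" for a
    using that pP pS unfolding Q_def Z_def by blast
  have CQ: "C a \<subseteq> Q a" if "a < n" for a
    using pQ[OF that] reach_in unfolding C_def by blast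
  have QU: "Q a \<subseteq> verts U" if "a < n" for a
    using P that unfolding Q_def by blast
  have QQ: "Q a \<inter> Q a' = {}" if "a < n" "a' < n" "a \<noteq> a'" for a a'
  proof -
    have False if z: "z \<in> Q a" "z \<in> Q a'" for z
    proof -
      obtain b b' where b: "b < n" "b' < n" "z \<in> P a b" "z \<in> P a' b'" "z \<notin> Z"
        using z unfolding Q_def by blast
      then have "z \<in> S b" using PP[of a b a' b'] \<open>a < n\<close> \<open>a' < n\<close> \<open>a \<noteq> a'\<close> by blast
      then show False using b unfolding Z_def by blast
    qed
    then show ?thesis by blast
  qed
  have QS: "Q a \<inter> S b = {}" if "b < n" for a b
    using that unfolding Q_def Z_def by blast
  have adjCS: "\<exists>x\<in>C a. \<exists>y\<in>S b. adj U x y" if ab: "a < n" "b < n" for a b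
  proof -
    obtain z where "z \<in> S b" "reach U (P a b) (p a) z" using reach[OF ab] by blast
    then obtain x y where xy: "y \<in> S b" "reach U (P a b - S b) (p a) x" "adj U x y"
      using reach_exit pS[OF ab] by blast
    \<comment> \<open>Before its entry into \<open>S b\<close> the walk meets no core at all:
      \<open>S b\<close> is excluded by the cut and the other cores by \<open>PS\<close>.\<close>
    have "z \<notin> Z" if "z \<in> P a b - S b" for z
    proof
      assume "z \<in> Z"
      then obtain b' where "b' < n" "z \<in> S b'" unfolding Z_def by blast
      then show False using that PS[OF ab, of b'] by (cases "b' = b") auto
    qed
    then have "P a b - S b \<subseteq> Q a" using ab unfolding Q_def by blast
    then have "x \<in> C a" using xy(2) reach_mono unfolding C_def by blast
    then show ?thesis using xy by blast
  qed
  have conn: "connected_set U (C a \<union> S a)" if a: "a < n" for a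
  proof (rule connected_setI)
    show "p a \<in> C a \<union> S a" by (simp add: C_def)
    show "C a \<union> S a \<subseteq> verts U" using CQ QU S a unfolding connected_set_def by blast
    have C: "reach U (C a \<union> S a) (p a) z" if "z \<in> C a" for z
      using that reach_component[of U "Q a" "p a" z] unfolding C_def
      by (auto intro: reach_mono)
    \<comment> \<open>The contact between tail and core of the same index is spent on
      connectedness.\<close>
    obtain x y where xy: "x \<in> C a" "y \<in> S a" "adj U x y" using adjCS[OF a a] by blast
    have "reach U (C a \<union> S a) (p a) z" if "z \<in> S a" for z
    proof -
      have "reach U (C a \<union> S a) y z"
        using connected_set_reach[OF S[OF a] xy(2) that] by (rule reach_mono) simp
      moreover have "reach U (C a \<union> S a) x y" using xy by (intro reach_step) auto
      ultimately show ?thesis using C[OF xy(1)] reach_trans by blast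
    qed
    then show "reach U (C a \<union> S a) (p a) z" if "z \<in> C a \<union> S a" for z
      using that C by blast
  qed
  obtain idx where idx: "bij_betw idx (verts M) {..<n}"
    using M ex_bij_betw_finite_nat[OF M(1)] by (auto simp: atLeast0LessThan)
  have lt: "idx v < n" if "v \<in> verts M" for v
    using idx that by (auto simp: bij_betw_def)
  have neq: "idx u \<noteq> idx v" if "u \<in> verts M" "v \<in> verts M" "u \<noteq> v" for u v
    using idx that by (auto simp: bij_betw_def inj_on_def)
  show ?thesis unfolding is_minor_def
  proof (intro exI[of _ "\<lambda>v. C (idx v) \<union> S (idx v)"] conjI ballI allI impI)
    fix v assume "v \<in> verts M"
    then show "connected_set U (C (idx v) \<union> S (idx v))" using conn lt by blast
  next
    fix u v assume uv: "u \<in> verts M" "v \<in> verts M" "u \<noteq> v"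
    show "(C (idx u) \<union> S (idx u)) \<inter> (C (idx v) \<union> S (idx v)) = {}"
      using CQ[OF lt[OF uv(1)]] CQ[OF lt[OF uv(2)]] QS[OF lt[OF uv(1)], of "idx v"]
        QQ[OF lt[OF uv(1)] lt[OF uv(2)] neq[OF uv]] QS[OF lt[OF uv(2)], of "idx u"]
        SS[OF lt[OF uv(1)] lt[OF uv(2)] neq[OF uv]] by blast
  next
    fix u v assume "adj M u v"
    then have "u \<in> verts M" "v \<in> verts M" by (auto simp: adj_def)
    then show "\<exists>x\<in>C (idx u) \<union> S (idx u). \<exists>y\<in>C (idx v) \<union> S (idx v). adj U x y"
      using adjCS lt by blast
  qed
qed

section \<open>Branch sets from balls in the host graph\<close>

lemma reach_relpowp:
  assumes "(adj G ^^ t) c z" "c \<in> verts G" "\<And>s y. s \<le> t \<Longrightarrow> (adj G ^^ s) c y \<Longrightarrow> y \<in> verts G \<Longrightarrow> y \<in> X"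
  shows "reach G X c z"
  using assms
proof (induction t arbitrary: z)
  case (Suc t)
  then obtain y where y: "(adj G ^^ t) c y" "adj G y z" by auto
  have yz: "y \<in> verts G" "z \<in> verts G" using y(2) by (auto simp: adj_def)
  have "y \<in> X" using Suc.prems(3)[OF _ y(1) yz(1)] by simp
  moreover have "z \<in> X" using Suc.prems(3)[OF _ Suc.prems(1) yz(2)] by simp
  moreover have "reach G X c y" using Suc.IH[OF y(1) Suc.prems(2)] Suc.prems(3) le_SucI by blast
  ultimately show ?case using y(2) reach_step reach_trans by blast
qed auto

text \<open>
  Think of \<open>f a\<close> and \<open>g b\<close> as the distances to \<open>p a\<close> and \<open>q b\<close>, truncated at 1, and of
  \<open>R a b\<close> as the steps of length \<open>\<delta>\<close> along a path from \<open>p a\<close> to \<open>q b\<close>.  The branch sets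
  are unions of balls of radius 1/6 around the images of the paths; since \<open>\<phi>\<close> does not
  contract, two balls that meet have centres at distance less than 1/3.
\<close>

lemma minor_of_short_steps:
  fixes f g :: "nat \<Rightarrow> 'v \<Rightarrow> real" and p q :: "nat \<Rightarrow> 'v" and \<phi> :: "'v \<Rightarrow> nat"
    and R :: "nat \<Rightarrow> nat \<Rightarrow> 'v \<Rightarrow> 'v \<Rightarrow> bool"
  assumes M: "finite (verts M)" "card (verts M) = n" and n: "0 < n" and \<delta>: "0 < \<delta>"
    and pV: "\<And>a. a < n \<Longrightarrow> p a \<in> V" and qV: "\<And>b. b < n \<Longrightarrow> q b \<in> V"
    and RV: "\<And>a b x y. R a b x y \<Longrightarrow> x \<in> V \<and> y \<in> V"
    and Rf: "\<And>a b a' x y. R a b x y \<Longrightarrow> f a' y = f a' x + (if a' = a then \<delta> else 0)"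
    and Rg: "\<And>a b b' x y. R a b x y \<Longrightarrow> g b' y = g b' x - (if b' = b then \<delta> else 0)"
    and fp: "\<And>a a'. f a' (p a) = (if a' = a then 0 else 1)"
    and gp: "\<And>a b. g b (p a) = 1" and gq: "\<And>b. g b (q b) = 0"
    and short: "\<And>a b x y. R a b x y \<Longrightarrow> \<exists>t. 6 * real t * \<delta> < 1 \<and> (adj U ^^ t) (\<phi> x) (\<phi> y)"
    and \<phi>: "\<And>x. x \<in> V \<Longrightarrow> \<phi> x \<in> verts U"
    and f_lip: "\<And>a x y t. x \<in> V \<Longrightarrow> y \<in> V \<Longrightarrow> (adj U ^^ t) (\<phi> x) (\<phi> y) \<Longrightarrow>
      \<bar>f a x - f a y\<bar> \<le> real t * \<delta>"
    and g_lip: "\<And>b x y t. x \<in> V \<Longrightarrow> y \<in> V \<Longrightarrow> (adj U ^^ t) (\<phi> x) (\<phi> y) \<Longrightarrow>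
      \<bar>g b x - g b y\<bar> \<le> real t * \<delta>"
    and path: "\<And>a b. a < n \<Longrightarrow> b < n \<Longrightarrow> (R a b)\<^sup>*\<^sup>* (p a) (q b)"
  shows "is_minor M U"
proof -
  \<comment> \<open>No path is chosen: all vertices on chains from \<open>p a\<close> to
    \<open>q b\<close> are used at once.\<close>
  define X where "X a b = {x. (R a b)\<^sup>*\<^sup>* (p a) x \<and> (R a b)\<^sup>*\<^sup>* x (q b)}" for a b
  define Ba where "Ba x = {z \<in> verts U. \<exists>t. 6 * real t * \<delta> < 1 \<and> (adj U ^^ t) (\<phi> x) z}" for x
  define P where "P a b = (\<Union>x\<in>X a b. Ba x)" for a b
  \<comment> \<open>Balls that meet have centres less than 1/3 apart, so a ball of this core meets
    only balls with \<open>g b\<close> below 2/3 at the centre. Chains towards another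
    \<open>q b'\<close> keep \<open>g b = 1\<close>.\<close>
  define S where "S b = (\<Union>a<n. \<Union>x\<in>{x \<in> X a b. 3 * g b x \<le> 1}. Ba x)" for b
  \<comment> \<open>A step raises \<open>f a\<close> and lowers \<open>g b\<close> by the same
    \<open>\<delta>\<close> and leaves all other potentials at 1.\<close>
  have from_p: "x \<in> V \<and> f a x + g b x = 1 \<and>
      (\<forall>a'. a' \<noteq> a \<longrightarrow> f a' x = 1) \<and> (\<forall>b'. b' \<noteq> b \<longrightarrow> g b' x = 1)"
    if "(R a b)\<^sup>*\<^sup>* (p a) x" "a < n" for a b x
    using that(1)
  proof (induction rule: rtranclp_induct)
    case base
    then show ?case using that pV fp gp by simp
  next
    case (step y z)
    then show ?case using RV[OF step.hyps(2)] Rf[OF step.hyps(2)] Rg[OF step.hyps(2)] by simp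
  qed
  have XV: "x \<in> V" and Xfg: "f a x + g b x = 1" and Xf: "a' \<noteq> a \<Longrightarrow> f a' x = 1"
    and Xg: "b' \<noteq> b \<Longrightarrow> g b' x = 1" if "x \<in> X a b" "a < n" for a b x a' b'
    using that from_p unfolding X_def by blast+
  have pX: "p a \<in> X a b" and qX: "q b \<in> X a b" if "a < n" "b < n" for a b
    using path that unfolding X_def by auto
  have centre: "\<phi> x \<in> Ba x" if "x \<in> V" for x
    using \<phi>[OF that] unfolding Ba_def by (auto intro!: exI[of _ 0])
  have reach_ball: "reach U Y (\<phi> x) z" if "z \<in> Ba x" "x \<in> V" "Ba x \<subseteq> Y" for x z Y
  proof -
    obtain t where t: "6 * real t * \<delta> < 1" "(adj U ^^ t) (\<phi> x) z" using \<open>z \<in> Ba x\<close> unfolding Ba_def by blast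
    have "reach U (Ba x) (\<phi> x) z"
    proof (rule reach_relpowp[OF t(2) \<phi>[OF that(2)]])
      fix s y assume s: "s \<le> t" "(adj U ^^ s) (\<phi> x) y" "y \<in> verts U"
      have "6 * real s * \<delta> \<le> 6 * real t * \<delta>"
        using s(1) \<delta> by (intro mult_right_mono) auto
      then have "6 * real s * \<delta> < 1" using t(1) by linarith
      then show "y \<in> Ba x" using s unfolding Ba_def by blast
    qed
    then show ?thesis using that(3) reach_mono by blast
  qed
  have reach_path: "reach U Y (\<phi> x) (\<phi> y)"
    if "(R a b)\<^sup>*\<^sup>* x y" "\<And>u. (R a b)\<^sup>*\<^sup>* x u \<Longrightarrow> (R a b)\<^sup>*\<^sup>* u y \<Longrightarrow> Ba u \<subseteq> Y" for a b x y Y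
    using that
  proof (induction rule: converse_rtranclp_induct)
    case (step u v)
    obtain t where "6 * real t * \<delta> < 1" "(adj U ^^ t) (\<phi> u) (\<phi> v)" using short[OF step.hyps(1)] by blast
    \<comment> \<open>A short step stays within the radius, so the next centre already lies in the
      current ball.\<close>
    then have "\<phi> v \<in> Ba u" using \<phi> RV[OF step.hyps(1)] unfolding Ba_def by blast
    moreover have "Ba u \<subseteq> Y" using step.prems[of u] step.hyps by (meson converse_rtranclp_into_rtranclp rtranclp.rtrancl_refl)
    ultimately have "reach U Y (\<phi> u) (\<phi> v)" using reach_ball RV[OF step.hyps(1)] by blast
    moreover have "reach U Y (\<phi> v) (\<phi> y)"
      using step.IH step.prems step.hyps(1) by (meson converse_rtranclp_into_rtranclp)
    ultimately show ?case by (rule reach_trans)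
  qed simp
  have meet: "\<exists>t. 3 * real t * \<delta> < 1 \<and> (adj U ^^ t) (\<phi> x) (\<phi> y)" if z: "z \<in> Ba x" "z \<in> Ba y" for x y z
  proof -
    obtain s t where st: "6 * real s * \<delta> < 1" "(adj U ^^ s) (\<phi> x) z" "6 * real t * \<delta> < 1" "(adj U ^^ t) (\<phi> y) z"
      using z unfolding Ba_def by blast
    have "(adj U ^^ (s + t)) (\<phi> x) (\<phi> y)"
      using relpowp_trans[OF st(2) relpowp_adj_sym[OF st(4)]] .
    moreover have "3 * real (s + t) * \<delta> < 1" using st by (simp add: algebra_simps)
    ultimately show ?thesis by blast
  qed
  have meet_f: "3 * \<bar>f a x - f a y\<bar> < 1" and meet_g: "3 * \<bar>g a x - g a y\<bar> < 1"
    if z: "z \<in> Ba x" "z \<in> Ba y" and xy: "x \<in> V" "y \<in> V" for a x y z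
  proof -
    obtain t where t: "3 * real t * \<delta> < 1" "(adj U ^^ t) (\<phi> x) (\<phi> y)" using meet[OF z] by blast
    show "3 * \<bar>f a x - f a y\<bar> < 1" "3 * \<bar>g a x - g a y\<bar> < 1"
      using f_lip[OF xy t(2), of a] g_lip[OF xy t(2), of a] t(1) by auto
  qed
  have PS0: "P a b \<inter> S b' = {}" if "a < n" "b \<noteq> b'" for a b b'
  proof -
    have False if z: "z \<in> P a b" "z \<in> S b'" for z
    proof -
      obtain x where x: "x \<in> X a b" "z \<in> Ba x" using z unfolding P_def by blast
      obtain a' y where y: "a' < n" "y \<in> X a' b'" "z \<in> Ba y" "3 * g b' y \<le> 1" using z unfolding S_def by blast
      have "g b' x = 1" using Xg[OF x(1) \<open>a < n\<close>] \<open>b \<noteq> b'\<close> by metis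
      then show False
        using meet_g[OF x(2) y(3) XV[OF x(1) \<open>a < n\<close>] XV[OF y(2,1)], of b'] y(4) by (auto simp: abs_if split: if_splits)
    qed
    then show ?thesis by blast
  qed
  have SP: "S b \<subseteq> (\<Union>a<n. P a b)" for b unfolding S_def P_def by blast
  show ?thesis
  proof (rule minor_of_cores[OF M, where S = S and P = P and p = "\<lambda>a. \<phi> (p a)"])
    fix b assume b: "b < n"
    have sub: "Ba x \<subseteq> S b" if "a < n" "x \<in> X a b" "3 * g b x \<le> 1" for a x
      using that unfolding S_def by blast
    show "connected_set U (S b)"
    proof (rule connected_setI)
      show "\<phi> (q b) \<in> S b" using sub[OF n qX[OF n b]] centre[OF qV[OF b]] gq by auto
      show "S b \<subseteq> verts U" unfolding S_def Ba_def by blast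
      fix z assume "z \<in> S b"
      then obtain a x where x: "a < n" "x \<in> X a b" "z \<in> Ba x" "3 * g b x \<le> 1" unfolding S_def by blast
      have "reach U (S b) (\<phi> x) z" using reach_ball[OF x(3) XV[OF x(2,1)] sub[OF x(1,2,4)]] .
      moreover have "reach U (S b) (\<phi> x) (\<phi> (q b))"
      proof (rule reach_path)
        show "(R a b)\<^sup>*\<^sup>* x (q b)" using x(2) unfolding X_def by blast
        fix u assume u: "(R a b)\<^sup>*\<^sup>* x u" "(R a b)\<^sup>*\<^sup>* u (q b)"
        \<comment> \<open>Since \<open>g b\<close> falls along the chain, its remainder up to
          \<open>q b\<close> stays in the core.\<close>
        have "g b u \<le> g b x" using u(1)
        proof (induction rule: rtranclp_induct)
          case (step y z)
          then show ?case using Rg[OF step.hyps(2), of b] \<delta> by simp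
        qed simp
        moreover have "u \<in> X a b" using u x(2) unfolding X_def by (auto intro: rtranclp_trans)
        ultimately show "Ba u \<subseteq> S b" using sub[OF x(1)] x(4) by simp
      qed
      ultimately show "reach U (S b) (\<phi> (q b)) z" using reach_sym reach_trans by blast
    qed
  next
    fix b b' assume "b < n" "b' < n" "b \<noteq> b'"
    then show "S b \<inter> S b' = {}" using SP[of b] PS0[of _ b b'] by blast
  next
    fix a b assume ab: "a < n" "b < n"
    show "P a b \<subseteq> verts U" unfolding P_def Ba_def by blast
    show "\<phi> (p a) \<in> P a b" using pX[OF ab] centre[OF pV[OF ab(1)]] unfolding P_def by blast
    show "\<phi> (p a) \<notin> S b"
    proof
      assume "\<phi> (p a) \<in> S b"
      then obtain a' y where y: "a' < n" "y \<in> X a' b" "\<phi> (p a) \<in> Ba y" "3 * g b y \<le> 1" unfolding S_def by blast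
      then show False
        using meet_g[OF centre[OF pV[OF ab(1)]] y(3) pV[OF ab(1)] XV[OF y(2,1)], of b] gp[of b a] by (auto simp: abs_if split: if_splits)
    qed
    have "\<phi> (q b) \<in> S b" using qX[OF ab] centre[OF qV[OF ab(2)]] gq ab unfolding S_def by force
    moreover have "reach U (P a b) (\<phi> (p a)) (\<phi> (q b))"
      by (rule reach_path[OF path[OF ab]]) (auto simp: P_def X_def)
    ultimately show "\<exists>z\<in>S b. reach U (P a b) (\<phi> (p a)) z" by blast
  next
    fix a b b' assume "a < n" "b < n" "b' < n" "b \<noteq> b'"
    then show "P a b \<inter> S b' = {}" using PS0 by blast
  next
    fix a b a' b' assume ab: "a < n" "b < n" "a' < n" "b' < n" "a \<noteq> a'"
    show "P a b \<inter> P a' b' \<subseteq> S b"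
    proof
      fix z assume "z \<in> P a b \<inter> P a' b'"
      then obtain x y where x: "x \<in> X a b" "z \<in> Ba x" and y: "y \<in> X a' b'" "z \<in> Ba y"
        unfolding P_def by blast
      \<comment> \<open>\<open>y\<close> belongs to another start, so \<open>f a y = 1\<close> and
        \<open>f a x\<close> exceeds 2/3. Hence \<open>g b x\<close> is below 1/3: chains with
        different starts can meet only within the core.\<close>
      have "3 * \<bar>f a x - 1\<bar> < 1"
        using meet_f[OF x(2) y(2) XV[OF x(1) ab(1)] XV[OF y(1) ab(3)], of a] Xf[OF y(1) ab(3,5)] by simp
      then have "3 * g b x \<le> 1" using Xfg[OF x(1) ab(1)] by (auto simp: abs_if split: if_splits)
      then show "z \<in> S b" using x ab unfolding S_def by blast
    qed
  qed
qed

section \<open>Tree decompositions from families of bags\<close>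

text \<open>Tree decompositions grown leaf by leaf, with the tree left implicit: \<open>Y\<close> is
  the bag of the node at which a new leaf with bag \<open>X\<close> is hung.\<close>

inductive bag_family :: "'a set set \<Rightarrow> bool" where
  single: "bag_family {X}"
| extend: "bag_family \<B> \<Longrightarrow> Y \<in> \<B> \<Longrightarrow> X \<inter> \<Union>\<B> \<subseteq> Y \<Longrightarrow> bag_family (insert X \<B>)"

text \<open>Whatever two new bags share is already old, so adding one of them does not stop the next
  from hanging on its own old bag.\<close>

lemma bag_family_extend_finite:
  assumes "bag_family \<B>" "finite I"
    and "\<And>i. i \<in> I \<Longrightarrow> \<exists>Y\<in>\<B>. X i \<inter> \<Union>\<B> \<subseteq> Y"
    and "\<And>i j. i \<in> I \<Longrightarrow> j \<in> I \<Longrightarrow> i \<noteq> j \<Longrightarrow> X i \<inter> X j \<subseteq> \<Union>\<B>"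
  shows "bag_family (\<B> \<union> X ` I)"
  using assms(2,3,4)
proof (induction I rule: finite_induct)
  case empty
  then show ?case using assms(1) by simp
next
  case (insert i I)
  obtain Y where Y: "Y \<in> \<B>" "X i \<inter> \<Union>\<B> \<subseteq> Y" using insert.prems(1)[of i] by blast
  have "X i \<inter> X j \<subseteq> \<Union>\<B>" if "j \<in> I" for j
    using insert.prems(2)[of i j] insert.hyps that by blast
  then have "X i \<inter> \<Union>(\<B> \<union> X ` I) \<subseteq> Y" using Y by blast
  moreover have "bag_family (\<B> \<union> X ` I)" using insert.IH insert.prems by blast
  ultimately have "bag_family (insert (X i) (\<B> \<union> X ` I))"
    using Y by (intro extend[of _ Y]) auto
  then show ?case by simp
qed

lemma bag_family_image:
  assumes "bag_family \<B>" "inj h"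
  shows "bag_family ((`) h ` \<B>)"
  using assms(1)
proof (induction rule: bag_family.induct)
  case (extend \<B> Y X)
  have "h ` X \<inter> \<Union>((`) h ` \<B>) = h ` (X \<inter> \<Union>\<B>)"
    using assms(2) by (auto simp: inj_def)
  then have "h ` X \<inter> \<Union>((`) h ` \<B>) \<subseteq> h ` Y" using extend.hyps(3) by auto
  then show ?case using extend by (auto intro: bag_family.extend)
qed (auto intro: bag_family.single)

lemma is_tree_add_leaf:
  assumes "is_tree T" "t \<in> verts T" "s \<notin> verts T"
  shows "is_tree (insert s (verts T), insert {s, t} (edges T))"
proof -
  let ?T = "(insert s (verts T), insert {s, t} (edges T))"
  have wf: "wf_graph T" and c: "connected_set T (verts T)" and e: "card (edges T) + 1 = card (verts T)"
    using assms(1) by (auto simp: is_tree_def)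
  have fin: "finite (verts T)" using wf by (simp add: wf_graph_def)
  have "edges T \<subseteq> Pow (verts T)" using wf by (auto simp: wf_graph_def)
  then have fine: "finite (edges T)" and new: "{s, t} \<notin> edges T"
    using fin assms(3) by (auto intro: finite_subset)
  have st: "s \<noteq> t" using assms by blast
  have "wf_graph ?T"
    unfolding wf_graph_def
  proof (intro conjI ballI)
    show "finite (verts ?T)" using fin by (simp add: verts_def)
    fix e assume "e \<in> edges ?T"
    then consider "e = {s, t}" | "e \<in> edges T" by (auto simp: edges_def)
    then show "\<exists>u v. u \<noteq> v \<and> e = {u, v} \<and> u \<in> verts ?T \<and> v \<in> verts ?T"
    proof cases
      case 1
      then show ?thesis using st assms(2) by (auto simp: verts_def)
    next
      case 2
      then obtain u v where "u \<noteq> v" "e = {u, v}" "u \<in> verts T" "v \<in> verts T"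
        using wf unfolding wf_graph_def by blast
      then show ?thesis by (auto simp: verts_def)
    qed
  qed
  moreover have "card (edges ?T) + 1 = card (verts ?T)"
    using e fin fine new assms(3) by (simp add: verts_def edges_def)
  moreover have "connected_set ?T (verts ?T)"
  proof (rule connected_setI[of t])
    fix z assume z: "z \<in> verts ?T"
    have *: "reach ?T (verts ?T) t z" if "z \<in> verts T"
    proof -
      have "reach T (verts T) t z" using connected_set_reach[OF c] assms(2) that by blast
      then show ?thesis unfolding reach_def
        by (rule rtranclp_mono[THEN predicate2D, rotated]) (auto simp: adj_def verts_def edges_def)
    qed
    have "adj ?T t s" using st assms by (auto simp: adj_def verts_def edges_def insert_commute)
    then have "reach ?T (verts ?T) t s" by (intro reach_step) (auto simp: adj_def)
    then show "reach ?T (verts ?T) t z" using * z by (auto simp: verts_def)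
  qed (use assms in \<open>auto simp: verts_def\<close>)
  ultimately show ?thesis by (simp add: is_tree_def)
qed

text \<open>Each \<open>extend\<close> hangs a new leaf on a node with bag \<open>Y\<close>. A
  vertex of the new bag that occurred before lies in \<open>Y\<close>, so the nodes holding it stay
  connected.\<close>

lemma bag_family_tree:
  assumes "bag_family \<B>"
  shows "\<exists>T bag. is_tree T \<and> bag ` verts T = \<B> \<and>
    (\<forall>v\<in>\<Union>\<B>. connected_set T {t \<in> verts T. v \<in> bag t})"
  using assms
proof (induction rule: bag_family.induct)
  case (single X)
  let ?T = "({0}, {}) :: graph"
  have "connected_set ?T {0}" by (rule connected_setI) (auto simp: verts_def)
  moreover have "is_tree ?T" using calculation by (auto simp: is_tree_def wf_graph_def verts_def edges_def)
  moreover have "{t \<in> verts ?T. v \<in> X} = {0}" if "v \<in> X" for v using that by (auto simp: verts_def)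
  ultimately show ?case by (intro exI[of _ ?T] exI[of _ "\<lambda>_. X"]) (simp add: verts_def)
next
  case (extend \<B> Y X)
  from extend.IH obtain T bag where T: "is_tree T" "bag ` verts T = \<B>"
    and c: "\<forall>v\<in>\<Union>\<B>. connected_set T {t \<in> verts T. v \<in> bag t}" by (elim exE conjE)
  obtain t where t: "t \<in> verts T" "bag t = Y" using T extend.hyps by blast
  have "finite (verts T)" using T by (auto simp: is_tree_def wf_graph_def)
  then obtain s where s: "s \<notin> verts T" using ex_new_if_finite infinite_UNIV_nat by blast
  let ?T = "(insert s (verts T), insert {s, t} (edges T))" and ?bag = "bag(s := X)"
  have vT: "verts ?T = insert s (verts T)" by (simp add: verts_def)
  have tree: "is_tree ?T" using is_tree_add_leaf[OF T(1) t(1) s] .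
  have bag: "?bag ` verts ?T = insert X \<B>" using T(2) s unfolding vT by auto
  have st: "s \<noteq> t" using s t by blast
  have adj: "adj ?T t s" using st t by (auto simp: adj_def verts_def edges_def insert_commute)
  have "connected_set ?T {u \<in> verts ?T. v \<in> ?bag u}" if v: "v \<in> \<Union>(insert X \<B>)" for v
  proof (cases "v \<in> \<Union>\<B>")
    case False
    then have eq: "{u \<in> verts ?T. v \<in> ?bag u} = {s}" using v T(2) s unfolding vT by auto
    show ?thesis unfolding eq by (rule connected_setI[of s]) (auto simp: vT)
  next
    case True
    let ?S = "{u \<in> verts T. v \<in> bag u}" and ?S' = "{u \<in> verts ?T. v \<in> ?bag u}"
    have S': "?S' = ?S \<union> (if v \<in> X then {s} else {})" using s unfolding vT by auto
    \<comment> \<open>The root for the connectedness proof: the neighbour \<open>t\<close> of the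
      new leaf if that leaf holds \<open>v\<close>, and any node holding \<open>v\<close>
      otherwise.\<close>
    obtain h where h: "h \<in> ?S" "v \<in> X \<Longrightarrow> h = t"
    proof (cases "v \<in> X")
      case True
      then have "t \<in> ?S" using \<open>v \<in> \<Union>\<B>\<close> extend.hyps(3) t by blast
      then show ?thesis using that by blast
    next
      case False
      then show ?thesis using that \<open>v \<in> \<Union>\<B>\<close> T(2) by blast
    qed
    have S: "reach ?T ?S' h z" if "z \<in> ?S" for z
    proof -
      have "reach T ?S h z" using connected_set_reach[OF bspec[OF c True] h(1) that] .
      then show ?thesis unfolding reach_def S'
        by (rule rtranclp_mono[THEN predicate2D, rotated]) (auto simp: adj_def verts_def edges_def)
    qed
    show ?thesis
    proof (rule connected_setI[of h])
      show "h \<in> ?S'" using h unfolding S' by blast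
      fix z assume z: "z \<in> ?S'"
      show "reach ?T ?S' h z"
      proof (cases "z \<in> ?S")
        case False
        then have "v \<in> X" "z = s" using z unfolding S' by (auto split: if_splits)
        then show ?thesis using adj h z unfolding S' by (intro reach_step) auto
      qed (rule S)
    qed auto
  qed
  then show ?case using tree bag by (intro exI[of _ ?T] exI[of _ ?bag]) blast
qed

lemma treewidth_le_bag_family:
  assumes "bag_family \<B>" "verts G = \<Union>\<B>"
    and "\<And>u v. adj G u v \<Longrightarrow> \<exists>X\<in>\<B>. u \<in> X \<and> v \<in> X"
    and "\<And>X. X \<in> \<B> \<Longrightarrow> card X \<le> k + 1"
  shows "treewidth_le G k"
proof -
  obtain T bag where T: "is_tree T" "bag ` verts T = \<B>"
    and c: "\<forall>v\<in>\<Union>\<B>. connected_set T {t \<in> verts T. v \<in> bag t}"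
    using bag_family_tree[OF assms(1)] by (elim exE conjE)
  have "tree_decomposition G T bag"
    unfolding tree_decomposition_def
  proof (intro conjI ballI allI impI)
    fix u v assume "adj G u v"
    then show "\<exists>t\<in>verts T. u \<in> bag t \<and> v \<in> bag t" using assms(3) T(2) by blast
  qed (use T c assms(2) in auto)
  then show ?thesis using assms(4) T(2) unfolding treewidth_le_def by blast
qed

section \<open>The recursive graphs\<close>

text \<open>
  An edge of the \<open>i\<close>-th graph is named by a word of \<open>i\<close> links, whose head is the most recent
  subdivision: replacing an edge by the gadget creates the edges source -- left (\<open>SL\<close>),
  left -- right (\<open>LR\<close>) and right -- sink (\<open>RT\<close>).  The vertices \<open>VL w a\<close> and \<open>VR w b\<close> are those
  created when the edge named \<open>w\<close> is replaced.
\<close>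

datatype link = SL nat | LR nat nat | RT nat

datatype vertex = Source | Sink | VL "link list" nat | VR "link list" nat

instance link :: countable by countable_datatype

instance vertex :: countable by countable_datatype

text \<open>An end that a gadget edge inherits from the replaced edge is looked up in the rest of
  the word; a fresh end is named by that rest.\<close>

fun src :: "link list \<Rightarrow> vertex" and tgt :: "link list \<Rightarrow> vertex" where
  "src [] = Source"
| "src (SL a # w) = src w"
| "src (LR a b # w) = VL w a"
| "src (RT b # w) = VR w b"
| "tgt [] = Sink"
| "tgt (SL a # w) = VL w a"
| "tgt (LR a b # w) = VR w b"
| "tgt (RT b # w) = tgt w"

text \<open>The index of the graph in which the vertex first appears; it tells fresh vertices from
  old ones.\<close>

fun lev :: "vertex \<Rightarrow> nat" where
  "lev Source = 0"
| "lev Sink = 0"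
| "lev (VL w a) = Suc (length w)"
| "lev (VR w b) = Suc (length w)"

definition links :: "nat \<Rightarrow> link set" where
  "links n = SL ` {..<n} \<union> (\<lambda>(a, b). LR a b) ` ({..<n} \<times> {..<n}) \<union> RT ` {..<n}"

definition words :: "nat \<Rightarrow> nat \<Rightarrow> link list set" where
  "words n i = {u. set u \<subseteq> links n \<and> length u = i}"

primrec gverts :: "nat \<Rightarrow> nat \<Rightarrow> vertex set" where
  "gverts n 0 = {Source, Sink}"
| "gverts n (Suc i) = gverts n i \<union> (\<lambda>(w, a). VL w a) ` (words n i \<times> {..<n})
     \<union> (\<lambda>(w, b). VR w b) ` (words n i \<times> {..<n})"

definition ggraph :: "nat \<Rightarrow> nat \<Rightarrow> graph" where
  "ggraph n i = (to_nat ` gverts n i, (\<lambda>u. {to_nat (src u), to_nat (tgt u)}) ` words n i)"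

lemma link_simps [simp]:
  "SL a \<in> links n \<longleftrightarrow> a < n" "LR a b \<in> links n \<longleftrightarrow> a < n \<and> b < n" "RT b \<in> links n \<longleftrightarrow> b < n"
  by (auto simp: links_def)

lemma finite_links [simp]: "finite (links n)"
  by (simp add: links_def)

lemma card_links: "card (links n) \<le> n * n + 2 * n"
proof -
  have "card (links n) \<le> card (SL ` {..<n}) + card ((\<lambda>(a, b). LR a b) ` ({..<n} \<times> {..<n})) + card (RT ` {..<n})"
    unfolding links_def by (meson add_le_mono1 card_Un_le le_trans)
  also have "\<dots> \<le> n + n * n + n"
    using card_image_le[of "{..<n}" SL] card_image_le[of "{..<n}" RT]
      card_image_le[of "{..<n} \<times> {..<n}" "\<lambda>(a, b). LR a b"]
    by (intro add_mono) (simp_all add: card_cartesian_product)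
  finally show ?thesis by simp
qed

lemma finite_words [simp]: "finite (words n i)"
  unfolding words_def by (rule finite_lists_length_eq) simp

lemma card_words: "card (words n i) \<le> (n * n + 2 * n) ^ i"
  unfolding words_def using card_links by (simp add: card_lists_length_eq power_mono)

lemma words_0 [simp]: "words n 0 = {[]}"
  by (auto simp: words_def)

lemma words_Cons [simp]: "l # u \<in> words n (Suc i) \<longleftrightarrow> l \<in> links n \<and> u \<in> words n i"
  by (auto simp: words_def)

lemma words_SucE:
  assumes "u \<in> words n (Suc i)"
  obtains (SL) a w where "u = SL a # w" "a < n" "w \<in> words n i"
    | (LR) a b w where "u = LR a b # w" "a < n" "b < n" "w \<in> words n i"
    | (RT) b w where "u = RT b # w" "b < n" "w \<in> words n i"
proof -
  obtain l w where u: "u = l # w" using assms by (cases u) (auto simp: words_def)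
  then show thesis using assms that by (cases l) auto
qed

lemma lev_src_tgt: "lev (src u) \<le> length u \<and> lev (tgt u) \<le> length u"
proof (induction u)
  case (Cons l u)
  then show ?case by (cases l) auto
qed simp

text \<open>A vertex created inside \<open>w\<close> has level \<open>Suc (length w)\<close>, above
  the levels of both ends of \<open>w\<close>.\<close>

lemma src_neq_tgt: "src u \<noteq> tgt u"
proof (cases u)
  case (Cons l w)
  have "src w \<noteq> VL w a" "tgt w \<noteq> VR w a" for a
    using lev_src_tgt[of w] by (metis Suc_n_not_le_n lev.simps(3,4))+
  from this this[symmetric] show ?thesis using Cons by (cases l) auto
qed simp

lemma src_tgt_gverts: "u \<in> words n i \<Longrightarrow> src u \<in> gverts n i \<and> tgt u \<in> gverts n i"
proof (induction i arbitrary: u)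
  case (Suc i)
  from Suc.prems show ?case by (cases rule: words_SucE) (use Suc.IH in force)+
qed simp

lemma lev_gverts: "x \<in> gverts n i \<Longrightarrow> lev x \<le> i"
  by (induction i) (auto simp: words_def)

lemma finite_gverts [simp]: "finite (gverts n i)"
  by (induction i) auto

lemma card_gverts:
  assumes "0 < n"
  shows "card (gverts n i) \<le> 2 * (n * n + 2 * n) ^ i"
proof (induction i)
  case (Suc i)
  let ?q = "n * n + 2 * n" and ?L = "(\<lambda>(w, a). VL w a) ` (words n i \<times> {..<n})"
    and ?R = "(\<lambda>(w, b). VR w b) ` (words n i \<times> {..<n})"
  have "card ?L \<le> card (words n i \<times> {..<n})" "card ?R \<le> card (words n i \<times> {..<n})"
    by (intro card_image_le; simp)+
  moreover have "card (words n i \<times> {..<n}) \<le> ?q ^ i * n"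
    using card_words by (simp add: card_cartesian_product)
  moreover have "card (gverts n (Suc i)) \<le> card (gverts n i) + card ?L + card ?R"
    using card_Un_le[of "gverts n i \<union> ?L" ?R] card_Un_le[of "gverts n i" ?L] by simp
  ultimately have "card (gverts n (Suc i)) \<le> 2 * ?q ^ i + ?q ^ i * n + ?q ^ i * n"
    using Suc.IH by linarith
  also have "\<dots> = ?q ^ i * (2 + 2 * n)" by (simp add: algebra_simps)
  also have "\<dots> \<le> ?q ^ i * (2 * ?q)"
  proof (intro mult_left_mono)
    show "2 + 2 * n \<le> 2 * ?q" using assms by (simp add: distrib_left)
  qed simp
  also have "\<dots> = 2 * ?q ^ Suc i" by (simp only: power_Suc mult_ac)
  finally show ?case .
qed simp

lemma words_nonempty: "0 < n \<Longrightarrow> replicate i (SL 0) \<in> words n i"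
  by (auto simp: words_def)

lemma gverts_strict: "0 < n \<Longrightarrow> gverts n i \<subset> gverts n (Suc i)"
proof
  assume n: "0 < n"
  have "VL (replicate i (SL 0)) 0 \<in> gverts n (Suc i)"
    using words_nonempty[OF n, of i] n by force
  moreover have "VL (replicate i (SL 0)) 0 \<notin> gverts n i"
    using lev_gverts[of "VL (replicate i (SL 0)) 0" n i] by auto
  ultimately show "gverts n i \<noteq> gverts n (Suc i)" by metis
qed auto

lemma verts_ggraph: "verts (ggraph n i) = to_nat ` gverts n i"
  by (simp add: ggraph_def verts_def)

lemma card_verts_ggraph: "card (verts (ggraph n i)) = card (gverts n i)"
  by (simp add: verts_ggraph card_image inj_on_def)

lemma wf_ggraph: "wf_graph (ggraph n i)"
  unfolding wf_graph_def
proof (intro conjI ballI)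
  fix e assume "e \<in> edges (ggraph n i)"
  then obtain u where u: "u \<in> words n i" "e = {to_nat (src u), to_nat (tgt u)}"
    by (auto simp: ggraph_def edges_def)
  then show "\<exists>x y. x \<noteq> y \<and> e = {x, y} \<and> x \<in> verts (ggraph n i) \<and> y \<in> verts (ggraph n i)"
    using src_tgt_gverts[OF u(1)] src_neq_tgt[of u] unfolding verts_ggraph
    by (intro exI[of _ "to_nat (src u)"] exI[of _ "to_nat (tgt u)"]) auto
qed (simp add: verts_ggraph)

lemma adj_ggraphE:
  assumes "adj (ggraph n i) x y"
  obtains u where "u \<in> words n i" "x = to_nat (src u) \<and> y = to_nat (tgt u) \<or> x = to_nat (tgt u) \<and> y = to_nat (src u)"
proof -
  obtain u where u: "u \<in> words n i" "{x, y} = {to_nat (src u), to_nat (tgt u)}"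
    using assms unfolding adj_def ggraph_def edges_def by auto
  show thesis by (rule that[OF u(1)]) (use u(2) in \<open>simp add: doubleton_eq_iff\<close>)
qed

lemma adj_ggraph:
  assumes "u \<in> words n i"
  shows "adj (ggraph n i) (to_nat (src u)) (to_nat (tgt u))"
  using src_tgt_gverts[OF assms] src_neq_tgt[of u] assms
  by (auto simp: adj_def ggraph_def verts_def edges_def)

section \<open>Tree decompositions of width \<open>n + 1\<close>\<close>

definition top_bag :: "nat \<Rightarrow> link list \<Rightarrow> vertex set" where
  "top_bag n w = {src w, tgt w} \<union> VL w ` {..<n}"

definition right_bag :: "nat \<Rightarrow> link list \<times> nat \<Rightarrow> vertex set" where
  "right_bag n = (\<lambda>(w, b). {tgt w, VR w b} \<union> VL w ` {..<n})"

text \<open>A replaced edge \<open>w\<close> contributes a bag with its two ends and all left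
  vertices, and for each right vertex a bag in which this vertex takes the place of the source.
  Treating right vertices one at a time keeps the size at \<open>n + 2\<close>.\<close>

primrec bags :: "nat \<Rightarrow> nat \<Rightarrow> vertex set set" where
  "bags n 0 = {{Source, Sink}}"
| "bags n (Suc i) = bags n i \<union> top_bag n ` words n i \<union> right_bag n ` (words n i \<times> {..<n})"

lemma Union_bags: "\<Union>(bags n i) = gverts n i"
proof (induction i)
  case (Suc i)
  let ?T = "\<Union>(top_bag n ` words n i)" and ?R = "\<Union>(right_bag n ` (words n i \<times> {..<n}))"
  have U: "\<Union>(bags n (Suc i)) = gverts n i \<union> ?T \<union> ?R"
    by (simp only: bags.simps Union_Un_distrib Suc.IH)
  show ?case
  proof
    have "?T \<subseteq> gverts n (Suc i)" by (auto simp: top_bag_def dest: src_tgt_gverts)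
    moreover have "?R \<subseteq> gverts n (Suc i)" by (auto simp: right_bag_def dest: src_tgt_gverts)
    ultimately show "\<Union>(bags n (Suc i)) \<subseteq> gverts n (Suc i)"
      unfolding U by (intro Un_least) auto
    have "(\<lambda>(w, a). VL w a) ` (words n i \<times> {..<n}) \<subseteq> ?T" by (auto simp: top_bag_def)
    moreover have "(\<lambda>(w, b). VR w b) ` (words n i \<times> {..<n}) \<subseteq> ?R" by (force simp: right_bag_def)
    ultimately show "gverts n (Suc i) \<subseteq> \<Union>(bags n (Suc i))"
      unfolding U gverts.simps by (intro Un_mono) auto
  qed
qed simp

text \<open>Besides covering the edges, this supplies the bag on which the next
  \<open>top_bag\<close> is hung.\<close>

lemma bags_edge: "u \<in> words n i \<Longrightarrow> \<exists>X\<in>bags n i. src u \<in> X \<and> tgt u \<in> X"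
proof (cases i)
  case (Suc j)
  assume "u \<in> words n i"
  then have "u \<in> words n (Suc j)" using Suc by simp
  then show ?thesis
  proof (cases rule: words_SucE)
    case (SL a w)
    then show ?thesis unfolding Suc by (intro bexI[of _ "top_bag n w"]) (auto simp: top_bag_def)
  next
    case (LR a b w)
    then show ?thesis unfolding Suc by (intro bexI[of _ "right_bag n (w, b)"]) (auto simp: right_bag_def)
  next
    case (RT b w)
    then show ?thesis unfolding Suc by (intro bexI[of _ "right_bag n (w, b)"]) (auto simp: right_bag_def)
  qed
qed simp

text \<open>Two rounds per subdivision: \<open>top_bag n w\<close> meets the old vertices only in
  the ends of \<open>w\<close>, which share an old bag; then each \<open>right_bag n (w, b)\<close>
  is hung on \<open>top_bag n w\<close>.\<close>

lemma bag_family_bags: "bag_family (bags n i)"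
proof (induction i)
  case 0
  show ?case by (simp add: bag_family.single)
next
  case (Suc i)
  have new: "VL w a \<notin> gverts n i" "VR w a \<notin> gverts n i" if "w \<in> words n i" for w a
    using lev_gverts[of _ n i] that by (force simp: words_def)+
  let ?\<B> = "bags n i \<union> top_bag n ` words n i"
  have U: "\<Union>?\<B> = gverts n i \<union> (\<Union>w\<in>words n i. VL w ` {..<n})"
    using src_tgt_gverts unfolding Union_Un_distrib Union_bags top_bag_def by blast
  have 1: "bag_family ?\<B>"
  proof (rule bag_family_extend_finite[OF Suc.IH])
    fix w assume w: "w \<in> words n i"
    have "top_bag n w \<inter> \<Union>(bags n i) \<subseteq> {src w, tgt w}"
      unfolding Union_bags top_bag_def using new[OF w] by blast
    then show "\<exists>Y\<in>bags n i. top_bag n w \<inter> \<Union>(bags n i) \<subseteq> Y"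
      using bags_edge[OF w] by blast
  next
    fix w w' assume w: "w \<in> words n i" "w' \<in> words n i" "w \<noteq> w'"
    show "top_bag n w \<inter> top_bag n w' \<subseteq> \<Union>(bags n i)"
      unfolding Union_bags top_bag_def
      using w(3) src_tgt_gverts[OF w(1)] src_tgt_gverts[OF w(2)] by auto
  qed simp
  have "bag_family (?\<B> \<union> right_bag n ` (words n i \<times> {..<n}))"
  proof (rule bag_family_extend_finite[OF 1])
    fix k assume k: "k \<in> words n i \<times> {..<n}"
    then obtain w b where wb: "k = (w, b)" "w \<in> words n i" "b < n" by blast
    have "VR w b \<notin> \<Union>?\<B>" unfolding U using new[OF wb(2)] by blast
    then have "right_bag n k \<inter> \<Union>?\<B> \<subseteq> top_bag n w"
      unfolding wb right_bag_def top_bag_def by auto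
    then show "\<exists>Y\<in>?\<B>. right_bag n k \<inter> \<Union>?\<B> \<subseteq> Y" using wb by blast
  next
    fix k k' assume k: "k \<in> words n i \<times> {..<n}" "k' \<in> words n i \<times> {..<n}" "k \<noteq> k'"
    then obtain w b w' b' where wb: "k = (w, b)" "w \<in> words n i" "k' = (w', b')" "w' \<in> words n i" by blast
    show "right_bag n k \<inter> right_bag n k' \<subseteq> \<Union>?\<B>"
      unfolding U wb right_bag_def using wb k(3) src_tgt_gverts[OF wb(2)] src_tgt_gverts[OF wb(4)] by auto
  qed simp
  then show ?case by simp
qed

lemma card_bags: "X \<in> bags n i \<Longrightarrow> card X \<le> n + 2"
proof (induction i)
  case (Suc i)
  have "card ({x, y} \<union> VL w ` {..<n}) \<le> n + 2" for x y w
    using card_Un_le[of "{x, y}" "VL w ` {..<n}"] card_image_le[of "{..<n}" "VL w"]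
      card_insert_le_m1[of 2 "{y}" x] by simp
  then show ?case using Suc by (auto simp: top_bag_def right_bag_def)
qed simp

lemma treewidth_ggraph: "treewidth_le (ggraph n i) (n + 1)"
proof (rule treewidth_le_bag_family)
  show "bag_family ((`) to_nat ` bags n i)"
    by (rule bag_family_image[OF bag_family_bags]) simp
  show "verts (ggraph n i) = \<Union>((`) to_nat ` bags n i)"
    by (simp add: verts_ggraph image_Union[symmetric] Union_bags)
  show "\<exists>X\<in>(`) to_nat ` bags n i. x \<in> X \<and> y \<in> X" if xy: "adj (ggraph n i) x y" for x y
  proof -
    obtain u where u: "u \<in> words n i"
      "x = to_nat (src u) \<and> y = to_nat (tgt u) \<or> x = to_nat (tgt u) \<and> y = to_nat (src u)"
      using xy by (rule adj_ggraphE)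
    obtain X where X: "X \<in> bags n i" "src u \<in> X" "tgt u \<in> X" using bags_edge[OF u(1)] by blast
    then have "x \<in> to_nat ` X" "y \<in> to_nat ` X" using u(2) by auto
    then show ?thesis using X(1) by blast
  qed
  show "card X \<le> n + 1 + 1" if "X \<in> (`) to_nat ` bags n i" for X
    using that card_bags by (auto simp: card_image inj_on_def)
qed

section \<open>Averages over words and stretched edges\<close>

text \<open>The weight of a word is that of a uniformly random edge of a random source-sink geodesic.\<close>

primrec avg :: "nat \<Rightarrow> nat \<Rightarrow> (link list \<Rightarrow> real) \<Rightarrow> link list \<Rightarrow> real" where
  "avg n 0 f e = f e"
| "avg n (Suc m) f e = (\<Sum>a<n. \<Sum>b<n.
     (avg n m f (SL a # e) + avg n m f (LR a b # e) + avg n m f (RT b # e)) / 3) / (real n)\<^sup>2"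

lemma avg_mono:
  assumes "e \<in> words n j" "\<And>u. u \<in> words n (j + m) \<Longrightarrow> f u \<le> g u"
  shows "avg n m f e \<le> avg n m g e"
  using assms
proof (induction m arbitrary: e j)
  case (Suc m)
  have "avg n m f (l # e) \<le> avg n m g (l # e)" if "l \<in> links n" for l
    using Suc.IH[of "l # e" "Suc j"] Suc.prems that by simp
  then show ?case
    by (auto intro!: divide_right_mono sum_mono add_mono)
qed simp

text \<open>Separates the outer \<open>j\<close> subdivisions from the inner \<open>m\<close>, so
  that a bound valid for each edge of the \<open>j\<close>-th graph can be averaged.\<close>

lemma avg_add: "avg n j (avg n m f) e = avg n (j + m) f e"
  by (induction j arbitrary: e) simp_all

lemma avg_const: "0 < n \<Longrightarrow> avg n m (\<lambda>_. c) e = c"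
  by (induction m arbitrary: e) (simp_all add: power2_eq_square)

lemma avg_plus: "avg n m (\<lambda>u. f u + g u) e = avg n m f e + avg n m g e"
proof (induction m arbitrary: e)
  case (Suc m)
  then show ?case by (simp only: avg.simps sum.distrib add_divide_distrib add_ac)
qed simp

lemma avg_scale: "avg n m (\<lambda>u. c * f u) e = c * avg n m f e"
proof (induction m arbitrary: e)
  case (Suc m)
  have "avg n (Suc m) (\<lambda>u. c * f u) e = (\<Sum>a<n. \<Sum>b<n.
     c * ((avg n m f (SL a # e) + avg n m f (LR a b # e) + avg n m f (RT b # e)) / 3)) / (real n)\<^sup>2"
    by (simp add: Suc.IH distrib_left)
  also have "\<dots> = c * avg n (Suc m) f e"
    by (simp only: avg.simps sum_distrib_left[symmetric] times_divide_eq_right[symmetric])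
  finally show ?case .
qed simp

lemma avg_sum:
  assumes "finite K"
  shows "avg n m (\<lambda>u. \<Sum>k\<in>K. f k u) e = (\<Sum>k\<in>K. avg n m (f k) e)"
  using assms
proof (induction K rule: finite_induct)
  case empty
  show ?case using avg_scale[of n m 0 "\<lambda>_. 0" e] by simp
qed (simp add: avg_plus)

lemma avg_integral:
  fixes f :: "'p \<Rightarrow> link list \<Rightarrow> real"
  assumes "\<And>u. integrable M (\<lambda>p. f p u)"
  shows "integrable M (\<lambda>p. avg n m (f p) e) \<and>
    (\<integral>p. avg n m (f p) e \<partial>M) = avg n m (\<lambda>u. \<integral>p. f p u \<partial>M) e"
proof (induction m arbitrary: e)
  case (Suc m)
  have i: "integrable M (\<lambda>p. avg n m (f p) e)" for e using Suc.IH by blast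
  have "(\<integral>p. avg n m (f p) e \<partial>M) = avg n m (\<lambda>u. \<integral>p. f p u \<partial>M) e" for e using Suc.IH by blast
  then show ?case using i by (simp add: integral_sum)
qed (use assms in auto)

section \<open>Chains of good edges and the weight of the bad ones\<close>

definition good_step :: "nat \<Rightarrow> (link list \<Rightarrow> bool) \<Rightarrow> nat \<Rightarrow> link list \<Rightarrow> vertex \<Rightarrow> vertex \<Rightarrow> bool" where
  "good_step n G m e x y \<longleftrightarrow> (\<exists>v\<in>words n m. G (v @ e) \<and> x = src (v @ e) \<and> y = tgt (v @ e))"

lemma good_step_Cons:
  assumes "good_step n G m (l # e) x y" "l \<in> links n"
  shows "good_step n G (Suc m) e x y"
proof -
  obtain v where "v \<in> words n m" "G (v @ l # e)" "x = src (v @ l # e)" "y = tgt (v @ l # e)"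
    using assms(1) unfolding good_step_def by blast
  then show ?thesis using assms(2) unfolding good_step_def
    by (intro bexI[of _ "v @ [l]"]) (auto simp: words_def)
qed

text \<open>Every forward path through the subdivided \<open>e\<close> has a bad edge among its
  \<open>3 ^ m\<close> edges. In the induction, good chains through all of \<open>SL a\<close>,
  \<open>LR a b\<close> and \<open>RT b\<close> would join to a good chain through \<open>e\<close>,
  so one of the three has enough bad weight for each choice of \<open>a\<close> and
  \<open>b\<close>.\<close>

lemma avg_bad_ge:
  assumes "0 < n" "e \<in> words n j" "\<not> (good_step n G m e)\<^sup>*\<^sup>* (src e) (tgt e)"
  shows "1 / 3 ^ m \<le> avg n m (\<lambda>u. of_bool (\<not> G u)) e"
  using assms(2,3)
proof (induction m arbitrary: e j)
  case 0
  then have "\<not> G e" by (auto simp: good_step_def)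
  then show ?case by simp
next
  case (Suc m)
  let ?A = "avg n m (\<lambda>u. of_bool (\<not> G u))"
  have nonneg: "0 \<le> ?A (l # e)" if "l \<in> links n" for l
    using avg_mono[of "l # e" n "Suc j" m "\<lambda>_. 0"] avg_const[OF assms(1)] Suc.prems(1) that by simp
  have *: "1 / 3 ^ m \<le> ?A (SL a # e) + ?A (LR a b # e) + ?A (RT b # e)" if ab: "a < n" "b < n" for a b
  proof (rule ccontr)
    assume small: "\<not> ?thesis"
    have "(good_step n G (Suc m) e)\<^sup>*\<^sup>* (src (l # e)) (tgt (l # e))"
      if l: "l \<in> {SL a, LR a b, RT b}" for l
    proof -
      have "l \<in> links n" using l ab by auto
      moreover have "?A (l # e) < 1 / 3 ^ m"
        using small nonneg[of "SL a"] nonneg[of "LR a b"] nonneg[of "RT b"] l ab by auto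
      ultimately have "(good_step n G m (l # e))\<^sup>*\<^sup>* (src (l # e)) (tgt (l # e))"
        using Suc.IH[of "l # e" "Suc j"] Suc.prems(1) by force
      then show ?thesis
        by (rule rtranclp_mono[THEN predicate2D, rotated]) (use good_step_Cons \<open>l \<in> links n\<close> in blast)
    qed
    from this[of "SL a"] this[of "LR a b"] this[of "RT b"]
    have "(good_step n G (Suc m) e)\<^sup>*\<^sup>* (src e) (tgt e)" by (auto intro: rtranclp_trans)
    then show False using Suc.prems(2) by blast
  qed
  have "1 / 3 ^ Suc m = (\<Sum>a<n. \<Sum>b<n. 1 / 3 ^ m / 3) / (real n)\<^sup>2"
    using assms(1) by (simp add: power2_eq_square)
  also have "\<dots> \<le> avg n (Suc m) (\<lambda>u. of_bool (\<not> G u)) e"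
    unfolding avg.simps by (intro divide_right_mono sum_mono) (use * in auto)
  finally show ?case .
qed

text \<open>
  A truncated distance from \<open>z\<close>: 0 at \<open>z\<close>, 1 at the other vertices of level at most \<open>J\<close>, and
  linear along the edges that are subdivided later.
\<close>

function pot :: "nat \<Rightarrow> vertex \<Rightarrow> vertex \<Rightarrow> real" where
  "pot J z x = (if lev x \<le> J then of_bool (x \<noteq> z) else
     (case x of VL w a \<Rightarrow> (2 * pot J z (src w) + pot J z (tgt w)) / 3
              | VR w b \<Rightarrow> (pot J z (src w) + 2 * pot J z (tgt w)) / 3
              | _ \<Rightarrow> 0))"
  by auto
termination
  by (relation "Wellfounded.measure (\<lambda>(J, z, x). lev x)") (use lev_src_tgt in \<open>auto simp: less_Suc_eq_le\<close>)

declare pot.simps [simp del]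

lemma pot_simps:
  "lev x \<le> J \<Longrightarrow> pot J z x = of_bool (x \<noteq> z)"
  "J \<le> length w \<Longrightarrow> pot J z (VL w a) = (2 * pot J z (src w) + pot J z (tgt w)) / 3"
  "J \<le> length w \<Longrightarrow> pot J z (VR w a) = (pot J z (src w) + 2 * pot J z (tgt w)) / 3"
  by (subst pot.simps; simp)+

text \<open>The values at left and right vertices interpolate at 1/3 and 2/3, so each subdivision
  splits the difference into three equal parts.\<close>

lemma pot_diff:
  assumes "length e = J"
  shows "pot J z (tgt (v @ e)) - pot J z (src (v @ e)) = (pot J z (tgt e) - pot J z (src e)) / 3 ^ length v"
proof (induction v)
  case (Cons l v)
  have "J \<le> length (v @ e)" using assms by simp
  then show ?case using Cons by (cases l) (simp_all add: pot_simps field_simps)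
qed simp

text \<open>Each edge descends from an edge of the \<open>J\<close>-th graph through
  \<open>m\<close> subdivisions. Across that ancestor the potential changes by at most 1, and
  \<open>pot_diff\<close> spreads the change evenly.\<close>

lemma pot_lipschitz:
  assumes "(adj (ggraph n (J + m)) ^^ t) (to_nat x) (to_nat y)"
  shows "\<bar>pot J z x - pot J z y\<bar> \<le> real t / 3 ^ m"
proof -
  have edge: "\<bar>pot J z (tgt u) - pot J z (src u)\<bar> \<le> 1 / 3 ^ m" if "u \<in> words n (J + m)" for u
  proof -
    \<comment> \<open>The most recent links come first, so dropping \<open>m\<close> of them leaves
      the ancestor.\<close>
    define v e where "v = take m u" and "e = drop m u"
    have ve: "u = v @ e" "length e = J" "length v = m" using that by (auto simp: v_def e_def words_def)
    have "lev (src e) \<le> J" "lev (tgt e) \<le> J" using lev_src_tgt[of e] ve by auto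
    then have "\<bar>pot J z (tgt e) - pot J z (src e)\<bar> \<le> 1" by (simp add: pot_simps)
    then show ?thesis using pot_diff[OF ve(2), of z v] ve by (simp add: divide_right_mono)
  qed
  have "\<bar>pot J z (from_nat p) - pot J z (from_nat q)\<bar> \<le> real t / 3 ^ m"
    if "(adj (ggraph n (J + m)) ^^ t) p q" for p q
    using that
  proof (induction t arbitrary: q)
    case (Suc t)
    then obtain r where r: "(adj (ggraph n (J + m)) ^^ t) p r" "adj (ggraph n (J + m)) r q" by auto
    obtain u where "u \<in> words n (J + m)"
      "r = to_nat (src u) \<and> q = to_nat (tgt u) \<or> r = to_nat (tgt u) \<and> q = to_nat (src u)"
      using r(2) by (rule adj_ggraphE)
    then have "\<bar>pot J z (from_nat r) - pot J z (from_nat q)\<bar> \<le> 1 / 3 ^ m"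
      using edge[of u] by (auto simp: abs_minus_commute)
    then show ?case using Suc.IH[OF r(1)] by (simp add: add_divide_distrib)
  qed simp
  from this[OF assms] show ?thesis by simp
qed

section \<open>Stretch under non-contracting maps\<close>

lemma gdist_le: "(adj G ^^ t) x y \<Longrightarrow> gdist G x y \<le> enat t"
  by (auto simp: gdist_def intro: Least_le)

definition non_contracting :: "graph \<Rightarrow> graph \<Rightarrow> (nat \<Rightarrow> nat) \<Rightarrow> bool" where
  "non_contracting H U \<phi> \<longleftrightarrow> (\<forall>x\<in>verts H. \<phi> x \<in> verts U) \<and>
     (\<forall>x\<in>verts H. \<forall>y\<in>verts H. gdist H x y \<le> gdist U (\<phi> x) (\<phi> y))"

text \<open>Domination in the form that the ball argument uses: the distance in \<open>H\<close> is
  at most the length of a walk in \<open>U\<close>, and in particular finite.\<close>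

lemma non_contracting_relpowp:
  assumes "non_contracting H U \<phi>" "x \<in> verts H" "y \<in> verts H" "(adj U ^^ t) (\<phi> x) (\<phi> y)"
  shows "\<exists>s\<le>t. (adj H ^^ s) x y"
proof -
  have "gdist U (\<phi> x) (\<phi> y) \<le> enat t"
    by (rule gdist_le[OF assms(4)])
  then have le: "gdist H x y \<le> enat t"
    using assms(1-3) unfolding non_contracting_def by (meson order_trans)
  then have ex: "\<exists>s. (adj H ^^ s) x y" by (auto simp: gdist_def split: if_splits)
  then have "(LEAST s. (adj H ^^ s) x y) \<le> t" using le by (simp add: gdist_def)
  then show ?thesis using LeastI_ex[OF ex] by blast
qed

text \<open>The bound \<open>3 ^ m / 6\<close>, multiplied out to stay in the naturals. It is the
  radius 1/6 once a geodesic of length \<open>3 ^ m\<close> is scaled to length 1.\<close>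

definition near :: "graph \<Rightarrow> (nat \<Rightarrow> nat) \<Rightarrow> nat \<Rightarrow> link list \<Rightarrow> bool" where
  "near U \<phi> m u \<longleftrightarrow> (\<exists>t. 6 * t < 3 ^ m \<and> (adj U ^^ t) (\<phi> (to_nat (src u))) (\<phi> (to_nat (tgt u))))"

text \<open>Otherwise \<open>minor_of_short_steps\<close> applies with
  \<open>\<delta> = 1 / 3 ^ m\<close> and the potentials of the left and right vertices created
  inside \<open>w\<close>: near chains give the paths, and domination with
  \<open>pot_lipschitz\<close> gives the Lipschitz bounds.\<close>

lemma copy_not_near:
  assumes M: "finite (verts M)" "card (verts M) = n" "0 < n" "\<not> is_minor M U"
    and nc: "non_contracting (ggraph n (Suc j + m)) U \<phi>" and w: "w \<in> words n j"
  shows "\<exists>a<n. \<exists>b<n. \<not> (good_step n (near U \<phi> m) m (LR a b # w))\<^sup>*\<^sup>* (VL w a) (VR w b)"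
proof (rule ccontr)
  assume con: "\<not> ?thesis"
  let ?J = "Suc j" and ?\<phi> = "\<lambda>x. \<phi> (to_nat (x :: vertex))"
  let ?V = "gverts n (?J + m)"
  define R where "R a b x y \<longleftrightarrow> a < n \<and> b < n \<and> good_step n (near U \<phi> m) m (LR a b # w) x y" for a b x y
  have lenw: "length w = j" using w by (simp add: words_def)
  have R: "\<exists>v. length v = m \<and> v @ LR a b # w \<in> words n (?J + m) \<and> near U \<phi> m (v @ LR a b # w) \<and>
      x = src (v @ LR a b # w) \<and> y = tgt (v @ LR a b # w)" if Rxy: "R a b x y" for a b x y
  proof -
    obtain v where "v \<in> words n m" "near U \<phi> m (v @ LR a b # w)"
      "x = src (v @ LR a b # w)" "y = tgt (v @ LR a b # w)"
      using Rxy unfolding R_def good_step_def by blast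
    moreover have "a < n" "b < n" using Rxy by (auto simp: R_def)
    ultimately show ?thesis using w by (intro exI[of _ v]) (auto simp: words_def)
  qed
  have pot_R: "pot ?J z y = pot ?J z x + (pot ?J z (VR w b) - pot ?J z (VL w a)) / 3 ^ m"
    if Rxy: "R a b x y" for a b x y z
  proof -
    obtain v where v: "length v = m" "x = src (v @ LR a b # w)" "y = tgt (v @ LR a b # w)"
      using R[OF Rxy] by blast
    show ?thesis using pot_diff[of "LR a b # w" ?J z v] lenw v by simp
  qed
  have sub: "gverts n (Suc j) \<subseteq> ?V"
    by (induction m) auto
  have LRV: "VL w a \<in> ?V" "VR w a \<in> ?V" if "a < n" for a
    using that w by (intro subsetD[OF sub]; force)+
  have lip: "\<bar>pot ?J z x - pot ?J z y\<bar> \<le> real t * (1 / 3 ^ m)"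
    if xy: "x \<in> ?V" "y \<in> ?V" and t: "(adj U ^^ t) (?\<phi> x) (?\<phi> y)" for x y z t
  proof -
    obtain s where s: "s \<le> t" "(adj (ggraph n (?J + m)) ^^ s) (to_nat x) (to_nat y)"
      using non_contracting_relpowp[OF nc _ _ t] xy by (auto simp: verts_ggraph)
    have "\<bar>pot ?J z x - pot ?J z y\<bar> \<le> real s / 3 ^ m" by (rule pot_lipschitz[OF s(2)])
    also have "\<dots> \<le> real t / 3 ^ m" using s(1) by (simp add: divide_right_mono)
    finally show ?thesis by simp
  qed
  have "is_minor M U"
  proof (rule minor_of_short_steps[OF M(1,2,3), where f = "\<lambda>a. pot ?J (VL w a)" and g = "\<lambda>b. pot ?J (VR w b)"
        and p = "VL w" and q = "VR w" and R = R and \<phi> = ?\<phi> and V = ?V and \<delta> = "1 / 3 ^ m"])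
    fix a b x y assume Rxy: "R a b x y"
    obtain v where v: "v @ LR a b # w \<in> words n (?J + m)" "near U \<phi> m (v @ LR a b # w)"
      "x = src (v @ LR a b # w)" "y = tgt (v @ LR a b # w)"
      using R[OF Rxy] by blast
    show "x \<in> ?V \<and> y \<in> ?V" using src_tgt_gverts[OF v(1)] v by simp
    show "pot ?J (VL w a') y = pot ?J (VL w a') x + (if a' = a then 1 / 3 ^ m else 0)" for a'
      using pot_R[OF Rxy, of "VL w a'"] lenw by (simp add: pot_simps)
    show "pot ?J (VR w b') y = pot ?J (VR w b') x - (if b' = b then 1 / 3 ^ m else 0)" for b'
      using pot_R[OF Rxy, of "VR w b'"] lenw by (simp add: pot_simps)
    obtain t where t: "6 * t < 3 ^ m" "(adj U ^^ t) (?\<phi> x) (?\<phi> y)"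
      using v(2) unfolding near_def v(3)[symmetric] v(4)[symmetric] by blast
    have "real (6 * t) < real (3 ^ m)" using t(1) by (simp only: of_nat_less_iff)
    then have "6 * real t * (1 / 3 ^ m) < 1" by simp
    then show "\<exists>t. 6 * real t * (1 / 3 ^ m) < 1 \<and> (adj U ^^ t) (?\<phi> x) (?\<phi> y)" using t(2) by blast
  next
    fix a b assume "a < n" "b < n"
    then have "(good_step n (near U \<phi> m) m (LR a b # w))\<^sup>*\<^sup>* (VL w a) (VR w b)" using con by blast
    then show "(R a b)\<^sup>*\<^sup>* (VL w a) (VR w b)"
      by (rule rtranclp_mono[THEN predicate2D, rotated]) (use \<open>a < n\<close> \<open>b < n\<close> in \<open>auto simp: R_def\<close>)
  next
    fix x assume "x \<in> ?V"
    then show "?\<phi> x \<in> verts U" using nc by (auto simp: non_contracting_def verts_ggraph)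
  qed (use LRV lip lenw in \<open>auto simp: pot_simps\<close>)
  then show False using M(4) by blast
qed

text \<open>The \<open>i\<close> subdivisions split into \<open>j\<close> outer ones, one gadget and
  \<open>m\<close> inner ones. In every such gadget some \<open>LR a b\<close>, of weight 1/(3 n^2),
  has at least the fraction \<open>1 / 3 ^ m\<close> of its edges stretched.\<close>

lemma avg_not_near_ge:
  assumes M: "finite (verts M)" "card (verts M) = n" "0 < n" "\<not> is_minor M U"
    and nc: "non_contracting (ggraph n i) U \<phi>" and m: "m < i"
  shows "1 / (3 ^ Suc m * (real n)\<^sup>2) \<le> avg n i (\<lambda>u. of_bool (\<not> near U \<phi> m u)) []"
proof -
  define j where "j = i - Suc m"
  have i: "i = Suc j + m" using m by (simp add: j_def)
  let ?f = "\<lambda>u. of_bool (\<not> near U \<phi> m u) :: real"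
  have nonneg: "0 \<le> avg n k ?f e" if "e \<in> words n l" for e k l
    using avg_mono[OF that, of k "\<lambda>_. 0" ?f] avg_const[OF M(3)] by simp
  have "1 / (3 ^ Suc m * (real n)\<^sup>2) \<le> avg n (Suc m) ?f w" if w: "w \<in> words n j" for w
  proof -
    obtain a b where ab: "a < n" "b < n"
      "\<not> (good_step n (near U \<phi> m) m (LR a b # w))\<^sup>*\<^sup>* (VL w a) (VR w b)"
      using copy_not_near[OF M nc[unfolded i] w] by blast
    have one: "1 / 3 ^ m \<le> avg n m ?f (LR a b # w)"
      using avg_bad_ge[OF M(3), of "LR a b # w" "Suc j" "near U \<phi> m" m] ab w by simp
    let ?t = "\<lambda>a b. (avg n m ?f (SL a # w) + avg n m ?f (LR a b # w) + avg n m ?f (RT b # w)) / 3"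
    have t: "0 \<le> ?t a b" if "a < n" "b < n" for a b
      using nonneg[of _ "Suc j" m] w that by simp
    have "1 / 3 ^ Suc m \<le> ?t a b"
      using one nonneg[of "SL a # w" "Suc j" m] nonneg[of "RT b # w" "Suc j" m] w ab by simp
    also have "\<dots> \<le> (\<Sum>b<n. ?t a b)" by (rule member_le_sum) (use t ab in auto)
    also have "\<dots> \<le> (\<Sum>a<n. \<Sum>b<n. ?t a b)"
      by (rule member_le_sum[of a _ "\<lambda>a. \<Sum>b<n. ?t a b"]) (use t ab in \<open>auto intro!: sum_nonneg\<close>)
    finally have "1 / 3 ^ Suc m / (real n)\<^sup>2 \<le> (\<Sum>a<n. \<Sum>b<n. ?t a b) / (real n)\<^sup>2"
      by (rule divide_right_mono) simp
    then show ?thesis by simp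
  qed
  then have "avg n j (\<lambda>_. 1 / (3 ^ Suc m * (real n)\<^sup>2)) [] \<le> avg n j (avg n (Suc m) ?f) []"
    by (intro avg_mono[of _ _ 0]) auto
  then show ?thesis unfolding avg_add avg_const[OF M(3)] i by simp
qed

section \<open>The lower bound\<close>

text \<open>A geometric sum with ratio 3 is at most 3/2 times its largest term.\<close>

lemma sum_powers_below_le:
  fixes x :: real
  assumes "0 \<le> x"
  shows "(\<Sum>m<i. if 3 ^ m \<le> x then 3 ^ m else 0) \<le> 3 / 2 * x"
proof (induction i)
  case (Suc i)
  show ?case
  proof (cases "3 ^ i \<le> x")
    case True
    have "(\<Sum>m<Suc i. if 3 ^ m \<le> x then 3 ^ m else 0) \<le> (\<Sum>m<Suc i. 3 ^ m :: real)"
      by (intro sum_mono) auto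
    also have "\<dots> \<le> 3 / 2 * (3 ^ i :: real)" by (subst sum_gp_strict) (simp add: field_simps)
    also have "\<dots> \<le> 3 / 2 * x" using True by simp
    finally show ?thesis .
  next
    case False
    then show ?thesis using Suc.IH by simp
  qed
qed (use assms in simp)

text \<open>At a finite distance \<open>d\<close>, failure of \<open>near\<close> at scale
  \<open>m\<close> forces \<open>3 ^ m \<le> 6 * d\<close>. Such powers sum to at most
  \<open>9 * d\<close>, whence the divisor 9; an infinite distance is trivial.\<close>

lemma sum_not_near_le_gdist:
  "ennreal (\<Sum>m<i. 3 ^ m / 9 * of_bool (\<not> near U \<phi> m u))
    \<le> ennreal_of_enat (gdist U (\<phi> (to_nat (src u))) (\<phi> (to_nat (tgt u))))"
proof (cases "gdist U (\<phi> (to_nat (src u))) (\<phi> (to_nat (tgt u)))")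
  case (enat d)
  then have d: "(adj U ^^ d) (\<phi> (to_nat (src u))) (\<phi> (to_nat (tgt u)))"
    by (auto simp: gdist_def split: if_splits intro: LeastI)
  have le: "3 ^ m \<le> 6 * real d" if "\<not> near U \<phi> m u" for m
  proof -
    have "3 ^ m \<le> 6 * d" using that d unfolding near_def by (meson not_less)
    then have "real (3 ^ m) \<le> real (6 * d)" by (simp only: of_nat_le_iff)
    then show ?thesis by simp
  qed
  have "(\<Sum>m<i. 3 ^ m / 9 * of_bool (\<not> near U \<phi> m u))
      \<le> (\<Sum>m<i. (if 3 ^ m \<le> 6 * real d then 3 ^ m else 0) / 9 :: real)"
    by (intro sum_mono) (use le in auto)
  also have "\<dots> \<le> (3 / 2 * (6 * real d)) / 9"
    unfolding sum_divide_distrib[symmetric] by (intro divide_right_mono sum_powers_below_le) auto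
  also have "\<dots> = real d" by simp
  finally show ?thesis unfolding enat by (simp add: ennreal_of_nat_eq_real_of_nat ennreal_leI)
qed simp

text \<open>Scale \<open>m\<close> contributes \<open>3 ^ m / 9\<close> times 1/(3^(m+1) n^2), that
  is 1/(27 n^2), to the average stretch for each host. Exchanging average and expectation compares
  the sum over all scales with the expected stretch of single edges.\<close>

lemma approx_lower_bound:
  assumes M: "finite (verts M)" "card (verts M) = n" "0 < n" and F: "\<And>G. G \<in> F \<Longrightarrow> \<not> is_minor M G"
    and i: "0 < i" and D: "is_approx F (ggraph n i) \<alpha> D"
  shows "real i / (27 * (real n)\<^sup>2) \<le> \<alpha>"
proof -
  define f where "f p u = (\<Sum>m<i. 3 ^ m / 9 * of_bool (\<not> near (fst p) (snd p) m u) :: real)"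
    for p :: "graph \<times> (nat \<Rightarrow> nat)" and u
  have f0: "0 \<le> f p u" for p u unfolding f_def by (intro sum_nonneg) auto
  have fB: "f p u \<le> (\<Sum>m<i. 3 ^ m / 9)" for p u unfolding f_def by (intro sum_mono) auto
  have int: "integrable (measure_pmf D) (\<lambda>p. f p u)" for u
    by (rule measure_pmf.integrable_const_bound[where B = "\<Sum>m<i. 3 ^ m / 9"]) (use f0 fB in auto)
  have "real i / (27 * (real n)\<^sup>2) \<le> avg n i (f p) []" if p: "p \<in> set_pmf D" for p
  proof -
    have nc: "non_contracting (ggraph n i) (fst p) (snd p)" and pF: "fst p \<in> F"
      using D p unfolding is_approx_def non_contracting_def by auto
    have "real i / (27 * (real n)\<^sup>2) = (\<Sum>m<i. 3 ^ m / 9 * (1 / (3 ^ Suc m * (real n)\<^sup>2)))"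
      by simp
    also have "\<dots> \<le> (\<Sum>m<i. 3 ^ m / 9 * avg n i (\<lambda>u. of_bool (\<not> near (fst p) (snd p) m u)) [])"
      using avg_not_near_ge[OF M F[OF pF] nc] by (intro sum_mono mult_left_mono) auto
    also have "\<dots> = avg n i (f p) []"
      unfolding f_def by (simp only: avg_sum[OF finite_lessThan] avg_scale)
    finally show ?thesis .
  qed
  then have "real i / (27 * (real n)\<^sup>2) \<le> (\<integral>p. avg n i (f p) [] \<partial>measure_pmf D)"
    using avg_integral[of "measure_pmf D" f n i "[]", OF int]
    by (intro measure_pmf.integral_ge_const) (auto simp: AE_measure_pmf_iff)
  also have "\<dots> = avg n i (\<lambda>u. \<integral>p. f p u \<partial>measure_pmf D) []"
    using avg_integral[of "measure_pmf D" f n i "[]", OF int] by blast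
  \<comment> \<open>\<open>ennreal\<close> sends a negative \<open>\<alpha>\<close> to 0, hence the
    maximum; it disappears at the end because the lower bound is positive.\<close>
  also have "\<dots> \<le> avg n i (\<lambda>_. max \<alpha> 0) []"
  proof (rule avg_mono[of _ _ 0])
    fix u assume "u \<in> words n (0 + i)"
    then have u: "u \<in> words n i" by simp
    let ?H = "ggraph n i" and ?x = "to_nat (src u)" and ?y = "to_nat (tgt u)"
    have xy: "?x \<in> verts ?H" "?y \<in> verts ?H" using src_tgt_gverts[OF u] by (auto simp: verts_ggraph)
    have "(adj ?H ^^ 1) ?x ?y" using adj_ggraph[OF u] by (simp only: relpowp_1)
    then have "gdist ?H ?x ?y \<le> enat 1" by (rule gdist_le)
    then have 1: "ennreal_of_enat (gdist ?H ?x ?y) \<le> 1"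
      using ennreal_of_enat_le_iff[of "gdist ?H ?x ?y" "enat 1"] by simp
    have "ennreal (\<integral>p. f p u \<partial>measure_pmf D) = (\<integral>\<^sup>+ p. ennreal (f p u) \<partial>measure_pmf D)"
      by (rule nn_integral_eq_integral[symmetric]) (use int f0 in auto)
    also have "\<dots> \<le> (\<integral>\<^sup>+ p. ennreal_of_enat (gdist (fst p) (snd p ?x) (snd p ?y)) \<partial>measure_pmf D)"
      unfolding f_def by (intro nn_integral_mono sum_not_near_le_gdist)
    also have "\<dots> \<le> ennreal \<alpha> * ennreal_of_enat (gdist ?H ?x ?y)"
      using D xy unfolding is_approx_def by blast
    also have "\<dots> \<le> ennreal \<alpha> * 1" by (intro mult_left_mono 1) simp
    also have "\<dots> = ennreal (max \<alpha> 0)" by (simp add: max_def ennreal_neg)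
    finally show "(\<integral>p. f p u \<partial>measure_pmf D) \<le> max \<alpha> 0" by (subst (asm) ennreal_le_iff) auto
  qed simp
  also have "\<dots> = max \<alpha> 0" by (rule avg_const[OF M(3)])
  finally have le: "real i / (27 * (real n)\<^sup>2) \<le> max \<alpha> 0" .
  moreover have "0 < real i / (27 * (real n)\<^sup>2)" using i M(3) by simp
  ultimately show ?thesis by (simp add: max_def split: if_splits)
qed

text \<open>The positive exponent \<open>Suc i\<close> absorbs the factor 2 from
  \<open>card_gverts\<close>. The crude bound of the logarithm by its argument costs only a factor
  polynomial in \<open>n\<close>.\<close>

lemma ln_card_ggraph_le:
  assumes "0 < n"
  shows "ln (real (card (verts (ggraph n (Suc i))))) \<le> real (Suc i) * (6 * (real n)\<^sup>2)"
proof -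
  have "gverts n (Suc i) \<noteq> {}" by (induction i) auto
  then have pos: "0 < card (gverts n (Suc i))" by (simp add: card_gt_0_iff)
  have "card (gverts n (Suc i)) \<le> 2 * (n * n + 2 * n) ^ Suc i" by (rule card_gverts[OF assms])
  also have "\<dots> \<le> 2 ^ Suc i * (n * n + 2 * n) ^ Suc i" by (intro mult_right_mono) auto
  also have "\<dots> = (2 * (n * n + 2 * n)) ^ Suc i" by (simp only: power_mult_distrib)
  also have "\<dots> \<le> (6 * n\<^sup>2) ^ Suc i"
  proof (rule power_mono)
    have "n \<le> n * n" using assms by simp
    then show "2 * (n * n + 2 * n) \<le> 6 * n\<^sup>2" by (simp add: power2_eq_square)
  qed simp
  finally have "real (card (gverts n (Suc i))) \<le> real ((6 * n\<^sup>2) ^ Suc i)"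
    by (simp only: of_nat_le_iff)
  also have "\<dots> = (6 * (real n)\<^sup>2) ^ Suc i"
    by (simp only: of_nat_power of_nat_mult of_nat_numeral)
  finally have "ln (real (card (gverts n (Suc i)))) \<le> ln ((6 * (real n)\<^sup>2) ^ Suc i)"
    using pos by (subst ln_le_cancel_iff) (use assms in auto)
  also have "\<dots> = real (Suc i) * ln (6 * (real n)\<^sup>2)"
    by (rule ln_realpow)
  also have "\<dots> \<le> real (Suc i) * (6 * (real n)\<^sup>2)"
    using assms by (intro mult_left_mono less_imp_le[OF ln_less_self]) auto
  finally show ?thesis by (simp add: card_verts_ggraph)
qed

text \<open>Serves the case \<open>n = 0\<close>. The bags are disjoint singletons, so each can be
  hung on \<open>{0}\<close>.\<close>

lemma treewidth_edgeless: "treewidth_le ({..i}, {}) k"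
proof (rule treewidth_le_bag_family)
  show "bag_family ((\<lambda>t. {t}) ` {..i})"
  proof (induction i)
    case 0
    show ?case by (simp add: bag_family.single)
  next
    case (Suc i)
    have "bag_family (insert {Suc i} ((\<lambda>t. {t}) ` {..i}))"
      by (rule bag_family.extend[OF Suc.IH, of "{0}"]) auto
    then show ?case by (simp add: atMost_Suc)
  qed
qed (auto simp: verts_def adj_def edges_def)

theorem theorem1:
  "\<exists>a b :: real. a > 0 \<and> b \<ge> 0 \<and>
    (\<forall>(F :: graph set) (M :: graph) (n :: nat).
      (\<forall>G\<in>F. wf_graph G) \<and> minor_closed F \<and> wf_graph M \<and> card (verts M) = n \<and>
      (\<forall>G\<in>F. \<not> is_minor M G) \<longrightarrow>
      (\<exists>H :: nat \<Rightarrow> graph.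
         (\<forall>i. wf_graph (H i) \<and> treewidth_le (H i) (n + 1)) \<and>
         strict_mono (\<lambda>i. card (verts (H i))) \<and>
         (\<forall>i \<alpha> D. is_approx F (H i) \<alpha> D \<longrightarrow>
            \<alpha> \<ge> (a / (real n + 1) powr b) * ln (real (card (verts (H i)))))))"
proof (rule exI[of _ "1/162"], rule exI[of _ 4], intro conjI allI impI)
  fix F :: "graph set" and M :: graph and n :: nat
  assume *: "(\<forall>G\<in>F. wf_graph G) \<and> minor_closed F \<and> wf_graph M \<and> card (verts M) = n \<and>
      (\<forall>G\<in>F. \<not> is_minor M G)"
  then have M: "finite (verts M)" "card (verts M) = n" and F: "\<And>G. G \<in> F \<Longrightarrow> \<not> is_minor M G"
    by (auto simp: wf_graph_def)
  show "\<exists>H :: nat \<Rightarrow> graph.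
         (\<forall>i. wf_graph (H i) \<and> treewidth_le (H i) (n + 1)) \<and>
         strict_mono (\<lambda>i. card (verts (H i))) \<and>
         (\<forall>i \<alpha> D. is_approx F (H i) \<alpha> D \<longrightarrow>
            \<alpha> \<ge> ((1/162) / (real n + 1) powr 4) * ln (real (card (verts (H i)))))"
  proof (cases "n = 0")
    case True
    \<comment> \<open>The empty graph is a minor of everything, so there is no distribution over \<open>F\<close> at all.\<close>
    then have "verts M = {}" using M by simp
    then have "is_minor M G" for G by (simp add: is_minor_def adj_def)
    then have "F = {}" using F by blast
    then have "\<not> is_approx F H \<alpha> D" for H \<alpha> D
      using set_pmf_not_empty[of D] by (auto simp: is_approx_def)
    then show ?thesis
      using treewidth_edgeless
      by (intro exI[of _ "\<lambda>i. ({..i}, {})"]) (auto simp: wf_graph_def verts_def edges_def strict_mono_def)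
  next
    case False
    then have n: "0 < n" by simp
    \<comment> \<open>The family starts at index 1, since the lower bound asks for at least one
      subdivision.\<close>
    have "\<alpha> \<ge> ((1/162) / (real n + 1) powr 4) * ln (real (card (verts (ggraph n (Suc i)))))"
      if D: "is_approx F (ggraph n (Suc i)) \<alpha> D" for i \<alpha> D
    proof -
      have "(real n) ^ 4 \<le> (real n + 1) ^ 4" by (intro power_mono) auto
      then have "(1/162) / (real n + 1) powr 4 \<le> (1/162) / (real n) ^ 4"
        using n by (simp add: powr_numeral frac_le)
      moreover have "0 \<le> ln (real (card (verts (ggraph n (Suc i)))))"
      proof -
        have "gverts n (Suc i) \<noteq> {}" by (induction i) auto
        then have "1 \<le> card (gverts n (Suc i))" by (simp add: Suc_le_eq card_gt_0_iff)
        then show ?thesis by (simp add: card_verts_ggraph)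
      qed
      ultimately have "((1/162) / (real n + 1) powr 4) * ln (real (card (verts (ggraph n (Suc i)))))
          \<le> ((1/162) / (real n) ^ 4) * (real (Suc i) * (6 * (real n)\<^sup>2))"
        using ln_card_ggraph_le[OF n, of i] by (intro mult_mono) auto
      \<comment> \<open>Here the constants are fixed: 162 is 27 times 6, and the exponent 4 collects
        one \<open>n\<^sup>2\<close> from the stretch bound and one from the size bound.\<close>
      also have "\<dots> = real (Suc i) / (27 * (real n)\<^sup>2)"
        using n by (simp add: field_simps eval_nat_numeral)
      also have "\<dots> \<le> \<alpha>" by (rule approx_lower_bound[OF M n F _ D]) simp_all
      finally show ?thesis .
    qed
    moreover have "strict_mono (\<lambda>i. card (verts (ggraph n (Suc i))))"
      unfolding strict_mono_Suc_iff card_verts_ggraph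
      using gverts_strict[OF n] finite_gverts psubset_card_mono by blast
    ultimately show ?thesis
      using wf_ggraph treewidth_ggraph by (intro exI[of _ "\<lambda>i. ggraph n (Suc i)"]) blast
  qed
qed simp_all

end
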